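(* Let $\mathcal{C}$ be an additive category, $\mathcal{D}$ an exact structure on $\mathcal{C}$, and $(\mathcal{A},\mathcal{B})$ a $\mathcal{D}$-perfect $\mathcal{D}$-cotorsion pair in $\mathcal{C}$. (1) Consider an exact structure $\mathcal{E}$ on $\mathcal{C}$ such that $\mathcal{A}$ coincides with the class of $\mathcal{D}$-$\mathcal{E}$-flat objects of $\mathcal{C}$ and assume that $\mathcal{E}\subseteq\mathcal{D}$. Then the following are equivalent for an object $X$ of $\mathcal{C}$: (i) $X$ is $\mathcal{D}$-$\mathcal{E}$-$\mathcal{A}$-divisible. (ii) The $\mathcal{B}$-envelope of $X$ relative to $\mathcal{D}$ is $\mathcal{D}$-$\mathcal{E}$-$\mathcal{A}$-divisible. (iii) There exists an $\mathcal{E}$-conflation $X\rightarrowtail B\twoheadrightarrow A$, where $A\in\mathcal{A}$ and $B\in\mathcal{B}$ is $\mathcal{D}$-$\mathcal{E}$-$\mathcal{A}$-divisible. (iv) There exists an $\mathcal{E}$-conflation $X\rightarrowtail Y\twoheadrightarrow A$, where $A\in\mathcal{A}$ and $Y$ is $\mathcal{D}$-$\mathcal{E}$-$\mathcal{A}$-divisible. (2) Consider an exact structure $\mathcal{E}$ on $\mathcal{C}$ such that $\mathcal{B}$ coincides with the class of $\mathcal{D}$-$\mathcal{E}$-divisible objects of $\mathcal{C}$ and assume that $\mathcal{E}\subseteq\mathcal{D}$. Then the following are equivalent for an object $Z$ of $\mathcal{C}$: (i) $Z$ is $\mathcal{D}$-$\mathcal{E}$-$\mathcal{B}$-flat. (ii)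 The $\mathcal{A}$-cover of $Z$ relative to $\mathcal{D}$ is $\mathcal{D}$-$\mathcal{E}$-$\mathcal{B}$-flat. (iii) There exists an $\mathcal{E}$-conflation $B\rightarrowtail A\twoheadrightarrow Z$, where $A\in\mathcal{A}$ is $\mathcal{D}$-$\mathcal{E}$-$\mathcal{B}$-flat and $B\in\mathcal{B}$. (iv) There exists an $\mathcal{E}$-conflation $B\rightarrowtail Y\twoheadrightarrow Z$, where $Y$ is $\mathcal{D}$-$\mathcal{E}$-$\mathcal{B}$-flat and $B\in\mathcal{B}$.
   Context: An exact structure $\mathcal{E}$ on an additive category $\mathcal{C}$ (Quillen, with Keller's axioms) is a distinguished class of kernel-cokernel pairs $X\rightarrowtail Y\twoheadrightarrow Z$, called $\mathcal{E}$-conflations (their kernels are $\mathcal{E}$-inflations, their cokernels $\mathcal{E}$-deflations), such that: $1_0$ is a deflation; deflations are closed under composition; pullbacks of deflations along arbitrary morphisms exist and are deflations; pushouts of inflations along arbitrary morphisms exist and are inflations. $\mathcal{E}\subseteq\mathcal{D}$ means every $\mathcal{E}$-conflation is a $\mathcal{D}$-conflation. $\mathrm{Ext}^1_{\mathcal{D}}(Z,X)=0$ iff every $\mathcal{D}$-conflation $X\rightarrowtail Y\twoheadrightarrow Z$ splits. A $\mathcal{D}$-cotorsion pair is a pair $(\mathcal{A},\mathcal{B})$ of classes of objects with $\mathcal{B}=\{X\mid \mathrm{Ext}^1_{\mathcal{D}}(A,X)=0\ \forall A\in\mathcal{A}\}$ and $\mathcal{A}=\{X\mid \mathrm{Ext}^1_{\mathcal{D}}(X,B)=0\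 \forall B\in\mathcal{B}\}$. Let $\mathcal{A}$ be a class of objects (closed under isomorphisms). An $\mathcal{A}$-precover relative to $\mathcal{D}$ of an object $C$ is a $\mathcal{D}$-deflation $f:X\twoheadrightarrow C$ with $X\in\mathcal{A}$ such that every morphism $X'\to C$ with $X'\in\mathcal{A}$ factors through $f$; it is an $\mathcal{A}$-cover relative to $\mathcal{D}$ if every endomorphism $g$ of $X$ with $fg=f$ is an automorphism. Dually, a $\mathcal{B}$-preenvelope relative to $\mathcal{D}$ of $C$ is a $\mathcal{D}$-inflation $f:C\rightarrowtail X$ with $X\in\mathcal{B}$ such that every morphism $C\to X'$ with $X'\in\mathcal{B}$ factors through $f$; it is a $\mathcal{B}$-envelope relative to $\mathcal{D}$ if every endomorphism $g$ of $X$ with $gf=f$ is an automorphism. The object $X$ itself is also referred to as the cover (resp. envelope). A $\mathcal{D}$-cotorsion pair $(\mathcal{A},\mathcal{B})$ is $\mathcal{D}$-perfect if every object of $\mathcal{C}$ has an $\mathcal{A}$-cover relative to $\mathcal{D}$ and a $\mathcal{B}$-envelope relative to $\mathcal{D}$. An object $X$ is $\mathcal{D}$-$\mathcal{E}$-divisible if every $\mathcal{D}$-inflation $X\rightarrowtail Y$ is an $\mathcal{E}$-inflation, and $\mathcal{D}$-$\mathcal{E}$-flat if every $\mathcal{D}$-deflation $Y\twoheadrightarrow X$ is an $\mathcal{E}$-deflation. For a class $\mathcal{A}$ of objects, $X$ is $\mathcal{D}$-$\mathcal{E}$-$\mathcal{A}$-divisible if every $\mathcal{D}$-inflation $X\rightarrowtail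 A$ with $A\in\mathcal{A}$ is an $\mathcal{E}$-inflation, and $\mathcal{D}$-$\mathcal{E}$-$\mathcal{A}$-flat if every $\mathcal{D}$-deflation $A\twoheadrightarrow X$ with $A\in\mathcal{A}$ is an $\mathcal{E}$-deflation (similarly with $\mathcal{B}$ in place of $\mathcal{A}$). *)

theory Defs
  imports "HOL-Algebra.Group"
begin

section \<open>Additive categories\<close>

text \<open>A category lives on a carrier set of objects and a carrier set of arrows. Every arrow
  determines its source and target, so distinct hom-sets are disjoint. Composition is written in
  the usual order: \<open>g \<cdot>\<^bsub>C\<^esub> f\<close> is \<open>f\<close> followed by \<open>g\<close>. Values outside the carriers are irrelevant.\<close>

record ('o, 'm) cat =
  obj :: "'o set"
  arr :: "'m set"
  src :: "'m \<Rightarrow> 'o"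
  tgt :: "'m \<Rightarrow> 'o"
  ident :: "'o \<Rightarrow> 'm"
  cmp :: "'m \<Rightarrow> 'm \<Rightarrow> 'm" (infixl "\<cdot>\<index>" 70)

record ('o, 'm) preadditive_cat = "('o, 'm) cat" +
  plus_arr :: "'m \<Rightarrow> 'm \<Rightarrow> 'm"
  zero_arr :: "'o \<Rightarrow> 'o \<Rightarrow> 'm"

definition Hom :: "('o, 'm, 'e) cat_scheme \<Rightarrow> 'o \<Rightarrow> 'o \<Rightarrow> 'm set" where
  "Hom C X Y = {f \<in> arr C. src C f = X \<and> tgt C f = Y}"

locale category =
  fixes C :: "('o, 'm, 'e) cat_scheme" (structure)
  assumes src_obj: "f \<in> arr C \<Longrightarrow> src C f \<in> obj C"
    and tgt_obj: "f \<in> arr C \<Longrightarrow> tgt C f \<in> obj C"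
    and ident_Hom: "X \<in> obj C \<Longrightarrow> ident C X \<in> Hom C X X"
    and cmp_Hom: "\<lbrakk>f \<in> Hom C X Y; g \<in> Hom C Y Z\<rbrakk> \<Longrightarrow> g \<cdot> f \<in> Hom C X Z"
    and cmp_assoc: "\<lbrakk>f \<in> Hom C X Y; g \<in> Hom C Y Z; h \<in> Hom C Z W\<rbrakk>
        \<Longrightarrow> (h \<cdot> g) \<cdot> f = h \<cdot> (g \<cdot> f)"
    and cmp_ident_left: "f \<in> Hom C X Y \<Longrightarrow> ident C Y \<cdot> f = f"
    and cmp_ident_right: "f \<in> Hom C X Y \<Longrightarrow> f \<cdot> ident C X = f"

definition Hom_group ::
    "('o, 'm, 'e) preadditive_cat_scheme \<Rightarrow> 'o \<Rightarrow> 'o \<Rightarrow> 'm monoid" where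
  "Hom_group C X Y = \<lparr>carrier = Hom C X Y, mult = plus_arr C, one = zero_arr C X Y\<rparr>"

definition is_iso :: "('o, 'm, 'e) cat_scheme \<Rightarrow> 'm \<Rightarrow> bool" where
  "is_iso C f \<longleftrightarrow> f \<in> arr C \<and>
     (\<exists>g \<in> Hom C (tgt C f) (src C f).
        g \<cdot>\<^bsub>C\<^esub> f = ident C (src C f) \<and> f \<cdot>\<^bsub>C\<^esub> g = ident C (tgt C f))"

definition is_zero_object :: "('o, 'm, 'e) cat_scheme \<Rightarrow> 'o \<Rightarrow> bool" where
  "is_zero_object C N \<longleftrightarrow> N \<in> obj C \<and>
     (\<forall>X \<in> obj C. (\<exists>!f. f \<in> Hom C N X) \<and> (\<exists>!f. f \<in> Hom C X N))"

definition is_biproduct ::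
    "('o, 'm, 'e) preadditive_cat_scheme \<Rightarrow> 'o \<Rightarrow> 'o \<Rightarrow> 'o \<Rightarrow> 'm \<Rightarrow> 'm \<Rightarrow> 'm \<Rightarrow> 'm \<Rightarrow> bool" where
  "is_biproduct C X Z Y i\<^sub>X i\<^sub>Z p\<^sub>X p\<^sub>Z \<longleftrightarrow>
     i\<^sub>X \<in> Hom C X Y \<and> i\<^sub>Z \<in> Hom C Z Y \<and> p\<^sub>X \<in> Hom C Y X \<and> p\<^sub>Z \<in> Hom C Y Z \<and>
     p\<^sub>X \<cdot>\<^bsub>C\<^esub> i\<^sub>X = ident C X \<and> p\<^sub>Z \<cdot>\<^bsub>C\<^esub> i\<^sub>Z = ident C Z \<and>
     p\<^sub>Z \<cdot>\<^bsub>C\<^esub> i\<^sub>X = zero_arr C X Z \<and> p\<^sub>X \<cdot>\<^bsub>C\<^esub> i\<^sub>Z = zero_arr C Z X \<and>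
     plus_arr C (i\<^sub>X \<cdot>\<^bsub>C\<^esub> p\<^sub>X) (i\<^sub>Z \<cdot>\<^bsub>C\<^esub> p\<^sub>Z) = ident C Y"

locale additive_category = category C
  for C :: "('o, 'm, 'e) preadditive_cat_scheme" (structure) +
  assumes Hom_comm_group: "\<lbrakk>X \<in> obj C; Y \<in> obj C\<rbrakk> \<Longrightarrow> comm_group (Hom_group C X Y)"
    and cmp_plus_left: "\<lbrakk>f \<in> Hom C X Y; g \<in> Hom C Y Z; g' \<in> Hom C Y Z\<rbrakk>
        \<Longrightarrow> plus_arr C g g' \<cdot> f = plus_arr C (g \<cdot> f) (g' \<cdot> f)"
    and cmp_plus_right: "\<lbrakk>f \<in> Hom C X Y; f' \<in> Hom C X Y; g \<in> Hom C Y Z\<rbrakk>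
        \<Longrightarrow> g \<cdot> plus_arr C f f' = plus_arr C (g \<cdot> f) (g \<cdot> f')"
    and zero_object_exists: "\<exists>N. is_zero_object C N"
    and biproduct_exists: "\<lbrakk>X \<in> obj C; Z \<in> obj C\<rbrakk>
        \<Longrightarrow> \<exists>Y i\<^sub>X i\<^sub>Z p\<^sub>X p\<^sub>Z. Y \<in> obj C \<and> is_biproduct C X Z Y i\<^sub>X i\<^sub>Z p\<^sub>X p\<^sub>Z"

section \<open>Exact structures\<close>

definition is_kernel :: "('o, 'm, 'e) preadditive_cat_scheme \<Rightarrow> 'm \<Rightarrow> 'm \<Rightarrow> bool" where
  "is_kernel C f g \<longleftrightarrow>
     f \<in> arr C \<and> g \<in> arr C \<and> tgt C f = src C g \<and>
     g \<cdot>\<^bsub>C\<^esub> f = zero_arr C (src C f) (tgt C g) \<and>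
     (\<forall>W \<in> obj C. \<forall>h \<in> Hom C W (src C g). g \<cdot>\<^bsub>C\<^esub> h = zero_arr C W (tgt C g)
        \<longrightarrow> (\<exists>!k. k \<in> Hom C W (src C f) \<and> f \<cdot>\<^bsub>C\<^esub> k = h))"

definition is_cokernel :: "('o, 'm, 'e) preadditive_cat_scheme \<Rightarrow> 'm \<Rightarrow> 'm \<Rightarrow> bool" where
  "is_cokernel C g f \<longleftrightarrow>
     f \<in> arr C \<and> g \<in> arr C \<and> tgt C f = src C g \<and>
     g \<cdot>\<^bsub>C\<^esub> f = zero_arr C (src C f) (tgt C g) \<and>
     (\<forall>W \<in> obj C. \<forall>h \<in> Hom C (tgt C f) W. h \<cdot>\<^bsub>C\<^esub> f = zero_arr C (src C f) W
        \<longrightarrow> (\<exists>!k. k \<in> Hom C (tgt C g) W \<and> k \<cdot>\<^bsub>C\<^esub> g = h))"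

text \<open>\<open>is_pullback C p f p' f'\<close>: \<open>p'\<close> is the pullback of \<open>p\<close> along \<open>f\<close>, with \<open>p \<cdot> f' = f \<cdot> p'\<close>.
  \<open>is_pushout C i f i' f'\<close>: \<open>i'\<close> is the pushout of \<open>i\<close> along \<open>f\<close>, with \<open>f' \<cdot> i = i' \<cdot> f\<close>.\<close>

definition is_pullback ::
    "('o, 'm, 'e) cat_scheme \<Rightarrow> 'm \<Rightarrow> 'm \<Rightarrow> 'm \<Rightarrow> 'm \<Rightarrow> bool" where
  "is_pullback C p f p' f' \<longleftrightarrow>
     p \<in> arr C \<and> f \<in> arr C \<and> p' \<in> arr C \<and> f' \<in> arr C \<and>
     tgt C p = tgt C f \<and> src C p' = src C f' \<and> tgt C p' = src C f \<and> tgt C f' = src C p \<and>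
     p \<cdot>\<^bsub>C\<^esub> f' = f \<cdot>\<^bsub>C\<^esub> p' \<and>
     (\<forall>W \<in> obj C. \<forall>u \<in> Hom C W (src C p). \<forall>v \<in> Hom C W (src C f). p \<cdot>\<^bsub>C\<^esub> u = f \<cdot>\<^bsub>C\<^esub> v
        \<longrightarrow> (\<exists>!k. k \<in> Hom C W (src C p') \<and> f' \<cdot>\<^bsub>C\<^esub> k = u \<and> p' \<cdot>\<^bsub>C\<^esub> k = v))"

definition is_pushout ::
    "('o, 'm, 'e) cat_scheme \<Rightarrow> 'm \<Rightarrow> 'm \<Rightarrow> 'm \<Rightarrow> 'm \<Rightarrow> bool" where
  "is_pushout C i f i' f' \<longleftrightarrow>
     i \<in> arr C \<and> f \<in> arr C \<and> i' \<in> arr C \<and> f' \<in> arr C \<and>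
     src C i = src C f \<and> tgt C i' = tgt C f' \<and> src C i' = tgt C f \<and> src C f' = tgt C i \<and>
     f' \<cdot>\<^bsub>C\<^esub> i = i' \<cdot>\<^bsub>C\<^esub> f \<and>
     (\<forall>W \<in> obj C. \<forall>u \<in> Hom C (tgt C i) W. \<forall>v \<in> Hom C (tgt C f) W. u \<cdot>\<^bsub>C\<^esub> i = v \<cdot>\<^bsub>C\<^esub> f
        \<longrightarrow> (\<exists>!k. k \<in> Hom C (tgt C i') W \<and> k \<cdot>\<^bsub>C\<^esub> f' = u \<and> k \<cdot>\<^bsub>C\<^esub> i' = v))"

definition conflation ::
    "('o, 'm, 'e) cat_scheme \<Rightarrow> ('m \<times> 'm) set \<Rightarrow> 'o \<Rightarrow> 'o \<Rightarrow> 'o \<Rightarrow> 'm \<Rightarrow> 'm \<Rightarrow> bool" where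
  "conflation C E X Y Z f g \<longleftrightarrow> (f, g) \<in> E \<and> f \<in> Hom C X Y \<and> g \<in> Hom C Y Z"

definition inflation :: "('m \<times> 'm) set \<Rightarrow> 'm \<Rightarrow> bool" where
  "inflation E f \<longleftrightarrow> (\<exists>g. (f, g) \<in> E)"

definition deflation :: "('m \<times> 'm) set \<Rightarrow> 'm \<Rightarrow> bool" where
  "deflation E g \<longleftrightarrow> (\<exists>f. (f, g) \<in> E)"

text \<open>As usual, the distinguished class of kernel-cokernel pairs is required to be closed under
  isomorphism of such pairs.\<close>

locale exact_structure = additive_category C
  for C :: "('o, 'm, 'e) preadditive_cat_scheme" (structure) +
  fixes E :: "('m \<times> 'm) set"
  assumes kernel_cokernel_pair: "(f, g) \<in> E \<Longrightarrow> is_kernel C f g \<and> is_cokernel C g f"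
    and iso_closed: "\<lbrakk>conflation C E X Y Z f g; f' \<in> Hom C X' Y'; g' \<in> Hom C Y' Z';
        a \<in> Hom C X X'; b \<in> Hom C Y Y'; c \<in> Hom C Z Z'; is_iso C a; is_iso C b; is_iso C c;
        b \<cdot> f = f' \<cdot> a; c \<cdot> g = g' \<cdot> b\<rbrakk> \<Longrightarrow> (f', g') \<in> E"
    and deflation_ident_zero: "is_zero_object C N \<Longrightarrow> deflation E (ident C N)"
    and deflation_cmp: "\<lbrakk>deflation E p; deflation E q; tgt C p = src C q\<rbrakk> \<Longrightarrow> deflation E (q \<cdot> p)"
    and pullback_exists: "\<lbrakk>deflation E p; f \<in> arr C; tgt C f = tgt C p\<rbrakk>
        \<Longrightarrow> \<exists>p' f'. is_pullback C p f p' f'"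
    and pullback_deflation: "\<lbrakk>deflation E p; is_pullback C p f p' f'\<rbrakk> \<Longrightarrow> deflation E p'"
    and pushout_exists: "\<lbrakk>inflation E i; f \<in> arr C; src C f = src C i\<rbrakk>
        \<Longrightarrow> \<exists>i' f'. is_pushout C i f i' f'"
    and pushout_inflation: "\<lbrakk>inflation E i; is_pushout C i f i' f'\<rbrakk> \<Longrightarrow> inflation E i'"

section \<open>Cotorsion pairs, covers and envelopes\<close>

text \<open>\<open>X \<rightarrow> Y \<rightarrow> Z\<close> splits if its maps are the injection of \<open>X\<close> into, and the projection onto \<open>Z\<close>
  of, a biproduct of \<open>X\<close> and \<open>Z\<close>.\<close>

definition splits ::
    "('o, 'm, 'e) preadditive_cat_scheme \<Rightarrow> 'o \<Rightarrow> 'o \<Rightarrow> 'o \<Rightarrow> 'm \<Rightarrow> 'm \<Rightarrow> bool" where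
  "splits C X Y Z f g \<longleftrightarrow> (\<exists>s r. is_biproduct C X Z Y f s r g)"

text \<open>\<open>Ext1_vanishes C D Z X\<close> stands for $\mathrm{Ext}^1_D(Z,X) = 0$; note the order of the
  arguments.\<close>

definition Ext1_vanishes ::
    "('o, 'm, 'e) preadditive_cat_scheme \<Rightarrow> ('m \<times> 'm) set \<Rightarrow> 'o \<Rightarrow> 'o \<Rightarrow> bool" where
  "Ext1_vanishes C D Z X \<longleftrightarrow> (\<forall>Y f g. conflation C D X Y Z f g \<longrightarrow> splits C X Y Z f g)"

definition cotorsion_pair ::
    "('o, 'm, 'e) preadditive_cat_scheme \<Rightarrow> ('m \<times> 'm) set \<Rightarrow> 'o set \<Rightarrow> 'o set \<Rightarrow> bool" where
  "cotorsion_pair C D \<A> \<B> \<longleftrightarrow>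
     \<A> \<subseteq> obj C \<and> \<B> \<subseteq> obj C \<and>
     \<B> = {X \<in> obj C. \<forall>A \<in> \<A>. Ext1_vanishes C D A X} \<and>
     \<A> = {X \<in> obj C. \<forall>B \<in> \<B>. Ext1_vanishes C D X B}"

definition is_precover ::
    "('o, 'm, 'e) cat_scheme \<Rightarrow> ('m \<times> 'm) set \<Rightarrow> 'o set \<Rightarrow> 'o \<Rightarrow> 'o \<Rightarrow> 'm \<Rightarrow> bool" where
  "is_precover C D \<A> Z X f \<longleftrightarrow>
     X \<in> \<A> \<and> f \<in> Hom C X Z \<and> deflation D f \<and>
     (\<forall>X' \<in> \<A>. \<forall>h \<in> Hom C X' Z. \<exists>k \<in> Hom C X' X. f \<cdot>\<^bsub>C\<^esub> k = h)"

definition is_cover ::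
    "('o, 'm, 'e) cat_scheme \<Rightarrow> ('m \<times> 'm) set \<Rightarrow> 'o set \<Rightarrow> 'o \<Rightarrow> 'o \<Rightarrow> 'm \<Rightarrow> bool" where
  "is_cover C D \<A> Z X f \<longleftrightarrow>
     is_precover C D \<A> Z X f \<and> (\<forall>g \<in> Hom C X X. f \<cdot>\<^bsub>C\<^esub> g = f \<longrightarrow> is_iso C g)"

definition is_preenvelope ::
    "('o, 'm, 'e) cat_scheme \<Rightarrow> ('m \<times> 'm) set \<Rightarrow> 'o set \<Rightarrow> 'o \<Rightarrow> 'o \<Rightarrow> 'm \<Rightarrow> bool" where
  "is_preenvelope C D \<B> Z X f \<longleftrightarrow>
     X \<in> \<B> \<and> f \<in> Hom C Z X \<and> inflation D f \<and>
     (\<forall>X' \<in> \<B>. \<forall>h \<in> Hom C Z X'. \<exists>k \<in> Hom C X X'. k \<cdot>\<^bsub>C\<^esub> f = h)"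

definition is_envelope ::
    "('o, 'm, 'e) cat_scheme \<Rightarrow> ('m \<times> 'm) set \<Rightarrow> 'o set \<Rightarrow> 'o \<Rightarrow> 'o \<Rightarrow> 'm \<Rightarrow> bool" where
  "is_envelope C D \<B> Z X f \<longleftrightarrow>
     is_preenvelope C D \<B> Z X f \<and> (\<forall>g \<in> Hom C X X. g \<cdot>\<^bsub>C\<^esub> f = f \<longrightarrow> is_iso C g)"

definition perfect_cotorsion_pair ::
    "('o, 'm, 'e) preadditive_cat_scheme \<Rightarrow> ('m \<times> 'm) set \<Rightarrow> 'o set \<Rightarrow> 'o set \<Rightarrow> bool" where
  "perfect_cotorsion_pair C D \<A> \<B> \<longleftrightarrow>
     cotorsion_pair C D \<A> \<B> \<and>
     (\<forall>Z \<in> obj C. (\<exists>X f. is_cover C D \<A> Z X f) \<and> (\<exists>X f. is_envelope C D \<B> Z X f))"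

section \<open>Relative divisibility and flatness\<close>

definition divisible ::
    "('o, 'm, 'e) cat_scheme \<Rightarrow> ('m \<times> 'm) set \<Rightarrow> ('m \<times> 'm) set \<Rightarrow> 'o \<Rightarrow> bool" where
  "divisible C D E X \<longleftrightarrow>
     X \<in> obj C \<and> (\<forall>Y \<in> obj C. \<forall>f \<in> Hom C X Y. inflation D f \<longrightarrow> inflation E f)"

definition flat ::
    "('o, 'm, 'e) cat_scheme \<Rightarrow> ('m \<times> 'm) set \<Rightarrow> ('m \<times> 'm) set \<Rightarrow> 'o \<Rightarrow> bool" where
  "flat C D E X \<longleftrightarrow>
     X \<in> obj C \<and> (\<forall>Y \<in> obj C. \<forall>f \<in> Hom C Y X. deflation D f \<longrightarrow> deflation E f)"

definition divisible_wrt ::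
    "('o, 'm, 'e) cat_scheme \<Rightarrow> ('m \<times> 'm) set \<Rightarrow> ('m \<times> 'm) set \<Rightarrow> 'o set \<Rightarrow> 'o \<Rightarrow> bool" where
  "divisible_wrt C D E \<A> X \<longleftrightarrow>
     X \<in> obj C \<and> (\<forall>A \<in> \<A>. \<forall>f \<in> Hom C X A. inflation D f \<longrightarrow> inflation E f)"

definition flat_wrt ::
    "('o, 'm, 'e) cat_scheme \<Rightarrow> ('m \<times> 'm) set \<Rightarrow> ('m \<times> 'm) set \<Rightarrow> 'o set \<Rightarrow> 'o \<Rightarrow> bool" where
  "flat_wrt C D E \<A> X \<longleftrightarrow>
     X \<in> obj C \<and> (\<forall>A \<in> \<A>. \<forall>f \<in> Hom C A X. deflation D f \<longrightarrow> deflation E f)"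

end

(*
Part (2) is part (1) in the opposite category. Passing there needs that inflations compose, which
is Keller's observation that this axiom of Quillen is redundant.

For part (1), write AA and BB for the two classes and let f : X -> B be the BB-envelope. By
Wakamatsu's lemma its cokernel A lies in AA, so it is flat and X -> B -> A is an E-conflation; this
gives (ii) => (iii).
(i) => (ii): if u : B -> A' is a D-inflation with A' in AA, then u f is an E-inflation, and its
cokernel Z is an E-quotient of a flat object, hence flat. So Ext(Z, B) = 0 and f = v (u f) for some
v. By the envelope property v u is invertible, so u splits and is an E-inflation.
(iv) => (i): push out a D-inflation u : X -> A' with A' in AA along X -> Y. The pushout P is an
extension of members of AA, so Y -> P is an E-inflation; hence so is X -> A' -> P, and u can be
recovered from it because A' -> P is an E-inflation too.
*)
theory Submission
  imports Defs
begin

section \<open>Additive categories\<close>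

text \<open>The obstacle to duality is that the axioms are lopsided: the identity of a zero object
  and composition are postulated for deflations only, whereas base change is given in both
  directions. The self-dual axioms are therefore kept apart, and whatever follows from them alone
  may be dualised at once, before composition of inflations is known. The cancellation used for this
  is weaker than Quillen's obscure axiom: the map to be cancelled must already belong to a
  kernel-cokernel pair. In the composition argument a diagram chase provides this; later the map
  comes from a \<open>D\<close>-conflation. Minimality of the envelope \<open>f\<close> enters twice
  by the same device, in Wakamatsu's lemma and in (i) => (ii): an endomorphism of \<open>B\<close>
  that fixes \<open>f\<close> is built from two maps through another object, and inverting it
  produces a splitting. The inclusion of \<open>E\<close> in \<open>D\<close> is what lets the
  vanishing of Ext relative to \<open>D\<close> act on \<open>E\<close>-conflations.\<close>

context category
begin

lemma HomD:
  assumes "f \<in> Hom C X Y"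
  shows "f \<in> arr C" "src C f = X" "tgt C f = Y" "X \<in> obj C" "Y \<in> obj C"
  using assms src_obj tgt_obj by (auto simp: Hom_def)

lemma Hom_iff [simp]: "f \<in> Hom C X Y \<longleftrightarrow> f \<in> arr C \<and> src C f = X \<and> tgt C f = Y"
  by (auto simp: Hom_def)

lemma ident_arr [simp]:
  "X \<in> obj C \<Longrightarrow> ident C X \<in> arr C"
  "X \<in> obj C \<Longrightarrow> src C (ident C X) = X"
  "X \<in> obj C \<Longrightarrow> tgt C (ident C X) = X"
  using ident_Hom[of X] by auto

lemma cmp_arr [simp]:
  assumes "f \<in> arr C" "g \<in> arr C" "src C g = tgt C f"
  shows "g \<cdot> f \<in> arr C" "src C (g \<cdot> f) = src C f" "tgt C (g \<cdot> f) = tgt C g"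
  using cmp_Hom[of f "src C f" "tgt C f" g "tgt C g"] assms by auto

lemma assoc [simp]:
  assumes "f \<in> arr C" "g \<in> arr C" "h \<in> arr C" "src C g = tgt C f" "src C h = tgt C g"
  shows "(h \<cdot> g) \<cdot> f = h \<cdot> (g \<cdot> f)"
  using cmp_assoc[of f "src C f" "tgt C f" g "tgt C g" h "tgt C h"] assms by auto

text \<open>Composites are normalised to the right, so an equation for \<open>g \<cdot> f\<close> no
  longer matches inside \<open>g \<cdot> (f \<cdot> h)\<close>. This is its form with a tail, for
  rewriting within longer composites.\<close>

lemma reassoc:
  assumes "g \<cdot> f = k" "f \<in> arr C" "g \<in> arr C" "h \<in> arr C" "src C g = tgt C f" "src C f = tgt C h"
  shows "g \<cdot> (f \<cdot> h) = k \<cdot> h"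
  using assms assoc[of h f g] by simp

lemma ident_cmp [simp]:
  "\<lbrakk>f \<in> arr C; tgt C f = Y\<rbrakk> \<Longrightarrow> ident C Y \<cdot> f = f"
  "\<lbrakk>f \<in> arr C; src C f = X\<rbrakk> \<Longrightarrow> f \<cdot> ident C X = f"
  using cmp_ident_left[of f "src C f" Y] cmp_ident_right[of f X "tgt C f"] by auto

lemma isoE:
  assumes "is_iso C f" "f \<in> Hom C X Y"
  obtains g where "g \<in> Hom C Y X" "g \<cdot> f = ident C X" "f \<cdot> g = ident C Y"
  using assms unfolding is_iso_def by auto

lemma isoI:
  assumes "f \<in> Hom C X Y" "g \<in> Hom C Y X" "g \<cdot> f = ident C X" "f \<cdot> g = ident C Y"
  shows "is_iso C f"
  using assms unfolding is_iso_def by auto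

lemma is_iso_ident: "X \<in> obj C \<Longrightarrow> is_iso C (ident C X)"
  by (rule isoI[of _ X X "ident C X"]) auto

text \<open>The unique existence of the universal property is split into existence and joint
  monicity, which are usually proved by unrelated arguments.\<close>

lemma pullbackI:
  assumes "p \<in> Hom C Y Z" "f \<in> Hom C V Z" "p' \<in> Hom C P V" "f' \<in> Hom C P Y" "p \<cdot> f' = f \<cdot> p'"
    and "\<And>W u v. \<lbrakk>u \<in> Hom C W Y; v \<in> Hom C W V; p \<cdot> u = f \<cdot> v\<rbrakk>
      \<Longrightarrow> \<exists>k \<in> Hom C W P. f' \<cdot> k = u \<and> p' \<cdot> k = v"
    and "\<And>W k k'. \<lbrakk>k \<in> Hom C W P; k' \<in> Hom C W P; f' \<cdot> k = f' \<cdot> k'; p' \<cdot> k = p' \<cdot> k'\<rbrakk> \<Longrightarrow> k = k'"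
  shows "is_pullback C p f p' f'"
proof -
  note [simp] = HomD[OF assms(1)] HomD[OF assms(2)] HomD[OF assms(3)] HomD[OF assms(4)]
  have "\<exists>!k. k \<in> Hom C W P \<and> f' \<cdot> k = u \<and> p' \<cdot> k = v"
    if uv: "u \<in> Hom C W Y" "v \<in> Hom C W V" "p \<cdot> u = f \<cdot> v" for W u v
    using assms(6)[OF uv] assms(7)[of _ W] by (metis (no_types, lifting))
  then show ?thesis
    using assms(5) unfolding is_pullback_def by (simp del: Hom_iff)
qed

lemma pullback_factor:
  assumes "is_pullback C p f p' f'" "p \<in> Hom C Y Z" "f \<in> Hom C V Z" "p' \<in> Hom C P V"
    "u \<in> Hom C W Y" "v \<in> Hom C W V" "p \<cdot> u = f \<cdot> v"
  obtains k where "k \<in> Hom C W P" "f' \<cdot> k = u" "p' \<cdot> k = v"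
proof -
  have "W \<in> obj C"
    using HomD[OF assms(5)] by simp
  then have "\<exists>!k. k \<in> Hom C W P \<and> f' \<cdot> k = u \<and> p' \<cdot> k = v"
    using assms HomD[OF assms(2)] HomD[OF assms(3)] HomD[OF assms(4)]
    unfolding is_pullback_def by blast
  then show ?thesis
    using that by blast
qed

lemma pullback_unique:
  assumes "is_pullback C p f p' f'" "p' \<in> Hom C P V"
    "k \<in> Hom C W P" "k' \<in> Hom C W P" "f' \<cdot> k = f' \<cdot> k'" "p' \<cdot> k = p' \<cdot> k'"
  shows "k = k'"
proof -
  note [simp] = HomD[OF assms(2)] HomD[OF assms(3)] HomD[OF assms(4)]
  have f': "p \<in> arr C" "f \<in> arr C" "f' \<in> arr C" "src C f' = P" "tgt C f' = src C p"
    "tgt C p' = src C f" "p \<cdot> f' = f \<cdot> p'" "V = src C f"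
    using assms(1,2) unfolding is_pullback_def by auto
  have "p \<cdot> (f' \<cdot> k) = f \<cdot> (p' \<cdot> k)"
    using reassoc[OF f'(7), of k] f'(1-6) by simp
  moreover have "f' \<cdot> k \<in> Hom C W (src C p)" "p' \<cdot> k \<in> Hom C W (src C f)" "W \<in> obj C"
    using f' by auto
  ultimately have "\<exists>!l. l \<in> Hom C W (src C p') \<and> f' \<cdot> l = f' \<cdot> k \<and> p' \<cdot> l = p' \<cdot> k"
    using assms(1) unfolding is_pullback_def by blast
  then show ?thesis
    using assms(3-6) HomD(2)[OF assms(2)] by metis
qed

text \<open>Allows either leg of a square to be the deflation that is pulled back. Read in the
  opposite category it does the same for pushouts of inflations.\<close>

lemma pullback_sym:
  assumes "is_pullback C p f p' f'"
  shows "is_pullback C f p f' p'"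
  using assms unfolding is_pullback_def by (simp add: conj_commute) metis

end

section \<open>Arithmetic of arrows, kernels, cokernels and biproducts\<close>

context additive_category
begin

abbreviation plus_local (infixl "\<oplus>" 65) where "f \<oplus> g \<equiv> plus_arr C f g"

abbreviation zero_local ("\<zero>") where "\<zero> \<equiv> zero_arr C"

lemma zero_arr_Hom [simp]:
  assumes "X \<in> obj C" "Y \<in> obj C"
  shows "\<zero> X Y \<in> arr C" "src C (\<zero> X Y) = X" "tgt C (\<zero> X Y) = Y"
proof -
  interpret G: comm_group "Hom_group C X Y"
    using Hom_comm_group[OF assms] .
  show "\<zero> X Y \<in> arr C" "src C (\<zero> X Y) = X" "tgt C (\<zero> X Y) = Y"
    using G.one_closed by (simp_all add: Hom_group_def)
qed

lemma plus_Hom [simp]: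
  assumes "f \<in> arr C" "g \<in> arr C" "src C f = src C g" "tgt C f = tgt C g"
  shows "f \<oplus> g \<in> arr C" "src C (f \<oplus> g) = src C g" "tgt C (f \<oplus> g) = tgt C g"
proof -
  interpret G: comm_group "Hom_group C (src C g) (tgt C g)"
    using Hom_comm_group assms src_obj tgt_obj by blast
  show "f \<oplus> g \<in> arr C" "src C (f \<oplus> g) = src C g" "tgt C (f \<oplus> g) = tgt C g"
    using G.m_closed[of f g] assms by (simp_all add: Hom_group_def)
qed

lemma plus_zero [simp]:
  assumes "f \<in> arr C" "src C f = X" "tgt C f = Y"
  shows "\<zero> X Y \<oplus> f = f" "f \<oplus> \<zero> X Y = f"
proof -
  interpret G: comm_group "Hom_group C X Y"
    using Hom_comm_group assms src_obj tgt_obj by blast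
  show "\<zero> X Y \<oplus> f = f" "f \<oplus> \<zero> X Y = f"
    using G.l_one[of f] G.r_one[of f] assms by (simp_all add: Hom_group_def)
qed

lemma plus_comm:
  assumes "f \<in> Hom C X Y" "g \<in> Hom C X Y"
  shows "f \<oplus> g = g \<oplus> f"
proof -
  interpret G: comm_group "Hom_group C X Y"
    using Hom_comm_group HomD[OF assms(1)] by blast
  show ?thesis
    using G.m_comm[of f g] assms by (simp add: Hom_group_def)
qed

lemma plus_assoc:
  assumes "f \<in> Hom C X Y" "g \<in> Hom C X Y" "h \<in> Hom C X Y"
  shows "(f \<oplus> g) \<oplus> h = f \<oplus> (g \<oplus> h)"
proof -
  interpret G: comm_group "Hom_group C X Y"
    using Hom_comm_group HomD[OF assms(1)] by blast
  show ?thesis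
    using G.m_assoc[of f g h] assms by (simp add: Hom_group_def)
qed

lemma plus_right_cancel:
  assumes "f \<oplus> h = g \<oplus> h" "f \<in> Hom C X Y" "g \<in> Hom C X Y" "h \<in> Hom C X Y"
  shows "f = g"
proof -
  interpret G: comm_group "Hom_group C X Y"
    using Hom_comm_group HomD[OF assms(2)] by blast
  show ?thesis
    using G.right_cancel[of h f g] assms by (simp add: Hom_group_def)
qed

lemma plus_eq_right_iff_zero:
  assumes "f \<oplus> h = h" "f \<in> Hom C X Y" "h \<in> Hom C X Y"
  shows "f = \<zero> X Y"
  using plus_right_cancel[of f h "\<zero> X Y" X Y] assms HomD[OF assms(2)] by simp

text \<open>Stands for \<open>f - g\<close>: the record carries an addition but no negation, so
  every later subtraction goes through this lemma.\<close>

lemma difference: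
  assumes "f \<in> Hom C X Y" "g \<in> Hom C X Y"
  obtains d where "d \<in> Hom C X Y" "d \<oplus> g = f"
proof -
  interpret G: comm_group "Hom_group C X Y"
    using Hom_comm_group HomD[OF assms(1)] by blast
  let ?G = "Hom_group C X Y"
  have fg: "f \<in> carrier ?G" "g \<in> carrier ?G"
    using assms by (simp_all add: Hom_group_def)
  then have "(f \<otimes>\<^bsub>?G\<^esub> inv\<^bsub>?G\<^esub> g) \<otimes>\<^bsub>?G\<^esub> g = f" "f \<otimes>\<^bsub>?G\<^esub> inv\<^bsub>?G\<^esub> g \<in> carrier ?G"
    by (simp_all add: G.m_assoc)
  then show ?thesis
    using that by (simp add: Hom_group_def)
qed

lemma cmp_plus [simp]:
  "\<lbrakk>f \<in> arr C; g \<in> arr C; h \<in> arr C; src C g = tgt C f; src C h = tgt C f; tgt C g = tgt C h\<rbrakk>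
    \<Longrightarrow> (g \<oplus> h) \<cdot> f = (g \<cdot> f) \<oplus> (h \<cdot> f)"
  "\<lbrakk>f \<in> arr C; g \<in> arr C; h \<in> arr C; src C h = tgt C f; src C h = tgt C g; src C f = src C g\<rbrakk>
    \<Longrightarrow> h \<cdot> (f \<oplus> g) = (h \<cdot> f) \<oplus> (h \<cdot> g)"
  using cmp_plus_left[of f "src C f" "tgt C f" g "tgt C g" h]
    cmp_plus_right[of f "src C f" "tgt C f" g h "tgt C h"] by auto

text \<open>Bilinearity makes a composite with a zero arrow equal to its own double, and in a group
  only zero has that property.\<close>

lemma cmp_zero [simp]:
  assumes "f \<in> arr C" "W \<in> obj C"
  shows "src C f = X \<Longrightarrow> f \<cdot> \<zero> W X = \<zero> W (tgt C f)"
    and "tgt C f = Y \<Longrightarrow> \<zero> Y W \<cdot> f = \<zero> (src C f) W"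
proof -
  define A B where "A = src C f" and "B = tgt C f"
  have f: "f \<in> Hom C A B"
    using assms by (simp add: A_def B_def)
  note [simp] = HomD[OF f] assms(2)
  have "f \<cdot> \<zero> W A = \<zero> W B"
  proof (rule plus_eq_right_iff_zero)
    have "f \<cdot> \<zero> W A \<oplus> f \<cdot> \<zero> W A = f \<cdot> (\<zero> W A \<oplus> \<zero> W A)"
      by (rule cmp_plus(2)[symmetric]) simp_all
    then show "f \<cdot> \<zero> W A \<oplus> f \<cdot> \<zero> W A = f \<cdot> \<zero> W A"
      by simp
  qed simp_all
  moreover have "\<zero> B W \<cdot> f = \<zero> A W"
  proof (rule plus_eq_right_iff_zero)
    have "\<zero> B W \<cdot> f \<oplus> \<zero> B W \<cdot> f = (\<zero> B W \<oplus> \<zero> B W) \<cdot> f"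
      by (rule cmp_plus(1)[symmetric]) simp_all
    then show "\<zero> B W \<cdot> f \<oplus> \<zero> B W \<cdot> f = \<zero> B W \<cdot> f"
      by simp
  qed simp_all
  ultimately show "src C f = X \<Longrightarrow> f \<cdot> \<zero> W X = \<zero> W (tgt C f)"
    "tgt C f = Y \<Longrightarrow> \<zero> Y W \<cdot> f = \<zero> (src C f) W"
    by auto
qed

lemma kernelI:
  assumes "f \<in> Hom C X Y" "g \<in> Hom C Y Z" "g \<cdot> f = \<zero> X Z"
    and "\<And>W h. \<lbrakk>h \<in> Hom C W Y; g \<cdot> h = \<zero> W Z\<rbrakk> \<Longrightarrow> \<exists>k \<in> Hom C W X. f \<cdot> k = h"
    and "\<And>W k k'. \<lbrakk>k \<in> Hom C W X; k' \<in> Hom C W X; f \<cdot> k = f \<cdot> k'\<rbrakk> \<Longrightarrow> k = k'"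
  shows "is_kernel C f g"
proof -
  note [simp] = HomD[OF assms(1)] HomD[OF assms(2)]
  have "\<exists>!k. k \<in> Hom C W X \<and> f \<cdot> k = h" if h: "h \<in> Hom C W Y" "g \<cdot> h = \<zero> W Z" for W h
    using assms(4)[OF h] assms(5)[of _ W] by (metis (no_types, lifting))
  then show ?thesis
    using assms(3) unfolding is_kernel_def by (simp del: Hom_iff)
qed

lemma kernel_zero:
  assumes "is_kernel C f g" "f \<in> Hom C X Y" "g \<in> Hom C Y Z"
  shows "g \<cdot> f = \<zero> X Z"
  using assms unfolding is_kernel_def by auto

lemma kernel_factor:
  assumes "is_kernel C f g" "f \<in> Hom C X Y" "g \<in> Hom C Y Z" "h \<in> Hom C W Y" "g \<cdot> h = \<zero> W Z"
  obtains k where "k \<in> Hom C W X" "f \<cdot> k = h"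
  using assms HomD[OF assms(2)] HomD[OF assms(3)] HomD[OF assms(4)] unfolding is_kernel_def
  by (metis (no_types, lifting))

lemma kernel_mono:
  assumes "is_kernel C f g" "f \<in> Hom C X Y" "g \<in> Hom C Y Z"
    "k \<in> Hom C W X" "k' \<in> Hom C W X" "f \<cdot> k = f \<cdot> k'"
  shows "k = k'"
proof -
  note [simp] = HomD[OF assms(2)] HomD[OF assms(3)] HomD[OF assms(4)] HomD[OF assms(5)]
  note [simp] = kernel_zero[OF assms(1-3)] kernel_zero[OF assms(1-3), THEN reassoc]
  have "g \<cdot> (f \<cdot> k) = \<zero> W Z" "f \<cdot> k \<in> Hom C W Y"
    by simp_all
  then have "\<exists>!l. l \<in> Hom C W X \<and> f \<cdot> l = f \<cdot> k"
    using assms(1) HomD(4)[OF assms(4)] unfolding is_kernel_def by simp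
  then show ?thesis
    using assms(4-6) by metis
qed

lemma cokernelI:
  assumes "f \<in> Hom C X Y" "g \<in> Hom C Y Z" "g \<cdot> f = \<zero> X Z"
    and "\<And>W h. \<lbrakk>h \<in> Hom C Y W; h \<cdot> f = \<zero> X W\<rbrakk> \<Longrightarrow> \<exists>k \<in> Hom C Z W. k \<cdot> g = h"
    and "\<And>W k k'. \<lbrakk>k \<in> Hom C Z W; k' \<in> Hom C Z W; k \<cdot> g = k' \<cdot> g\<rbrakk> \<Longrightarrow> k = k'"
  shows "is_cokernel C g f"
proof -
  note [simp] = HomD[OF assms(1)] HomD[OF assms(2)]
  have "\<exists>!k. k \<in> Hom C Z W \<and> k \<cdot> g = h" if h: "h \<in> Hom C Y W" "h \<cdot> f = \<zero> X W" for W h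
    using assms(4)[OF h] assms(5)[of _ W] by (metis (no_types, lifting))
  then show ?thesis
    using assms(3) unfolding is_cokernel_def by (simp del: Hom_iff)
qed

lemma cokernel_factor:
  assumes "is_cokernel C g f" "f \<in> Hom C X Y" "g \<in> Hom C Y Z" "h \<in> Hom C Y W" "h \<cdot> f = \<zero> X W"
  obtains k where "k \<in> Hom C Z W" "k \<cdot> g = h"
  using assms HomD[OF assms(2)] HomD[OF assms(3)] HomD[OF assms(4)] unfolding is_cokernel_def
  by (metis (no_types, lifting))

lemma cokernel_epi:
  assumes "is_cokernel C g f" "f \<in> Hom C X Y" "g \<in> Hom C Y Z"
    "k \<in> Hom C Z W" "k' \<in> Hom C Z W" "k \<cdot> g = k' \<cdot> g"
  shows "k = k'"
proof -
  note [simp] = HomD[OF assms(2)] HomD[OF assms(3)] HomD[OF assms(4)] HomD[OF assms(5)]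
  have [simp]: "g \<cdot> f = \<zero> X Z"
    using assms(1-3) unfolding is_cokernel_def by auto
  have "(k \<cdot> g) \<cdot> f = \<zero> X W" "k \<cdot> g \<in> Hom C Y W"
    by simp_all
  then have "\<exists>!l. l \<in> Hom C Z W \<and> l \<cdot> g = k \<cdot> g"
    using assms(1) HomD(5)[OF assms(4)] unfolding is_cokernel_def by (simp del: assoc)
  then show ?thesis
    using assms(4-6) by metis
qed

lemma zero_object_Hom_eq:
  assumes "is_zero_object C N"
  shows "f \<in> Hom C N X \<Longrightarrow> g \<in> Hom C N X \<Longrightarrow> f = g"
    and "f \<in> Hom C X N \<Longrightarrow> g \<in> Hom C X N \<Longrightarrow> f = g"
  using assms HomD(4,5) unfolding is_zero_object_def by (metis (no_types, lifting))+

text \<open>The retraction comes from factoring \<open>id - s \<cdot> g\<close> through the kernel of \<open>g\<close>.\<close>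

lemma splits_of_section:
  assumes "is_kernel C f g" "f \<in> Hom C X Y" "g \<in> Hom C Y Z" "s \<in> Hom C Z Y" "g \<cdot> s = ident C Z"
  shows "\<exists>r. is_biproduct C X Z Y f s r g"
proof -
  note [simp] = HomD[OF assms(2)] HomD[OF assms(3)] HomD[OF assms(4)] assms(5)
    assms(5)[THEN reassoc]
  note gf [simp] = kernel_zero[OF assms(1-3)]
  obtain d where d: "d \<in> Hom C Y Y" "d \<oplus> s \<cdot> g = ident C Y"
    using difference[of "ident C Y" Y Y "s \<cdot> g"] by auto
  note [simp] = HomD[OF d(1)]
  have "g \<cdot> (d \<oplus> s \<cdot> g) = g"
    by (simp only: d(2)) simp
  then have "g \<cdot> d \<oplus> g = g"
    by simp
  then have "g \<cdot> d = \<zero> Y Z"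
    by (rule plus_eq_right_iff_zero) auto
  then obtain r where r: "r \<in> Hom C Y X" "f \<cdot> r = d"
    using kernel_factor[OF assms(1-3) d(1)] by blast
  note [simp] = HomD[OF r(1)] r(2) r(2)[THEN reassoc]
  \<comment> \<open>Composing \<open>id = f \<cdot> r \<oplus> s \<cdot> g\<close> with
    \<open>f\<close> and later with \<open>s\<close> gives
    \<open>f \<cdot> (r \<cdot> f) = f\<close> and
    \<open>f \<cdot> (r \<cdot> s) = \<zero> Z Y\<close>; the monic \<open>f\<close> can then be
    cancelled.\<close>
  have "(d \<oplus> s \<cdot> g) \<cdot> f = f"
    by (simp only: d(2)) simp
  then have "d \<cdot> f = f"
    by simp
  then have rf: "r \<cdot> f = ident C X"
    by - (rule kernel_mono[OF assms(1-3), of _ X]; simp)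
  have "(d \<oplus> s \<cdot> g) \<cdot> s = s"
    by (simp only: d(2)) simp
  then have "d \<cdot> s \<oplus> s = s"
    by simp
  then have "d \<cdot> s = \<zero> Z Y"
    by (rule plus_eq_right_iff_zero) auto
  then have rs: "r \<cdot> s = \<zero> Z X"
    by - (rule kernel_mono[OF assms(1-3), of _ Z]; simp)
  show ?thesis
    unfolding is_biproduct_def by (intro exI[of _ r]) (use rf rs d in auto)
qed

lemma biproduct_objects:
  assumes "X \<in> obj C" "Z \<in> obj C"
  obtains Y iX iZ pX pZ where "is_biproduct C X Z Y iX iZ pX pZ"
  using biproduct_exists[OF assms] by blast

lemma biproductD:
  assumes "is_biproduct C X Z Y iX iZ pX pZ"
  shows "iX \<in> Hom C X Y" "iZ \<in> Hom C Z Y" "pX \<in> Hom C Y X" "pZ \<in> Hom C Y Z"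
    "pX \<cdot> iX = ident C X" "pZ \<cdot> iZ = ident C Z" "pZ \<cdot> iX = \<zero> X Z" "pX \<cdot> iZ = \<zero> Z X"
    "iX \<cdot> pX \<oplus> iZ \<cdot> pZ = ident C Y"
  using assms unfolding is_biproduct_def by auto

lemma biproduct_Hom_eq:
  assumes "is_biproduct C X Z Y iX iZ pX pZ" "k \<in> Hom C W Y" "k' \<in> Hom C W Y"
    "pX \<cdot> k = pX \<cdot> k'" "pZ \<cdot> k = pZ \<cdot> k'"
  shows "k = k'"
proof -
  note b = biproductD[OF assms(1)]
  note [simp] = HomD[OF b(1)] HomD[OF b(2)] HomD[OF b(3)] HomD[OF b(4)] HomD[OF assms(2)]
    HomD[OF assms(3)]
  have "(iX \<cdot> pX \<oplus> iZ \<cdot> pZ) \<cdot> k = (iX \<cdot> pX \<oplus> iZ \<cdot> pZ) \<cdot> k'"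
    using assms(4,5) by simp
  then show ?thesis
    by (simp only: b(9)) simp
qed

lemma biproduct_pair:
  assumes "is_biproduct C X Z Y iX iZ pX pZ" "u \<in> Hom C W X" "v \<in> Hom C W Z"
  shows "iX \<cdot> u \<oplus> iZ \<cdot> v \<in> Hom C W Y" "pX \<cdot> (iX \<cdot> u \<oplus> iZ \<cdot> v) = u" "pZ \<cdot> (iX \<cdot> u \<oplus> iZ \<cdot> v) = v"
proof -
  note b = biproductD[OF assms(1)]
  note [simp] = HomD[OF b(1)] HomD[OF b(2)] HomD[OF b(3)] HomD[OF b(4)] HomD[OF assms(2)]
    HomD[OF assms(3)] b(5-8) b(5-8)[THEN reassoc]
  show "iX \<cdot> u \<oplus> iZ \<cdot> v \<in> Hom C W Y" "pX \<cdot> (iX \<cdot> u \<oplus> iZ \<cdot> v) = u" "pZ \<cdot> (iX \<cdot> u \<oplus> iZ \<cdot> v) = v"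
    by auto
qed

lemma biproduct_kernel:
  assumes "is_biproduct C X Z Y iX iZ pX pZ"
  shows "is_kernel C iX pZ"
proof -
  note b = biproductD[OF assms]
  note [simp] = HomD[OF b(1)] HomD[OF b(2)] HomD[OF b(3)] HomD[OF b(4)] b(5-8)
    b(5-8)[THEN reassoc]
  show ?thesis
  proof (rule kernelI[OF b(1,4,7)])
    fix W h assume h: "h \<in> Hom C W Y" "pZ \<cdot> h = \<zero> W Z"
    note [simp] = HomD[OF h(1)] h(2)
    show "\<exists>k \<in> Hom C W X. iX \<cdot> k = h"
      by (rule bexI[of _ "pX \<cdot> h"], rule biproduct_Hom_eq[OF assms, of _ W]) auto
  next
    fix W k k' assume k: "k \<in> Hom C W X" "k' \<in> Hom C W X" "iX \<cdot> k = iX \<cdot> k'"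
    note [simp] = HomD[OF k(1)] HomD[OF k(2)]
    have "pX \<cdot> (iX \<cdot> k) = pX \<cdot> (iX \<cdot> k')"
      by (simp only: k(3))
    then show "k = k'"
      by simp
  qed
qed

lemma biproduct_commute:
  assumes "is_biproduct C X Z Y iX iZ pX pZ"
  shows "is_biproduct C Z X Y iZ iX pZ pX"
proof -
  note b = biproductD[OF assms]
  note [simp] = HomD[OF b(1)] HomD[OF b(2)] HomD[OF b(3)] HomD[OF b(4)]
  have "iZ \<cdot> pZ \<oplus> iX \<cdot> pX = ident C Y"
    using plus_comm[of "iZ \<cdot> pZ" Y Y "iX \<cdot> pX"] b(9) by simp
  then show ?thesis
    using b unfolding is_biproduct_def by simp
qed

end

section \<open>The opposite category\<close>

text \<open>The result stays in the same record type, so a theorem can be instantiated at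
  \<open>op_cat C\<close> and rewritten into one about \<open>C\<close>. The indices of
  \<open>zero_arr\<close> are swapped because they name source and target.\<close>

definition op_cat ::
    "('o, 'm, 'e) preadditive_cat_scheme \<Rightarrow> ('o, 'm, 'e) preadditive_cat_scheme" where
  "op_cat C = C\<lparr>src := tgt C, tgt := src C, cmp := (\<lambda>g f. cmp C f g),
     zero_arr := (\<lambda>X Y. zero_arr C Y X)\<rparr>"

lemma op_cat_simps [simp]:
  "obj (op_cat C) = obj C" "arr (op_cat C) = arr C" "src (op_cat C) = tgt C"
  "tgt (op_cat C) = src C" "ident (op_cat C) = ident C" "cmp (op_cat C) g f = cmp C f g"
  "plus_arr (op_cat C) = plus_arr C" "zero_arr (op_cat C) X Y = zero_arr C Y X"
  by (simp_all add: op_cat_def)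

lemma Hom_op [simp]: "Hom (op_cat C) X Y = Hom C Y X"
  by (auto simp: Hom_def)

lemma is_iso_op [simp]: "is_iso (op_cat C) f \<longleftrightarrow> is_iso C f"
  unfolding is_iso_def by auto

lemma is_zero_object_op [simp]: "is_zero_object (op_cat C) N \<longleftrightarrow> is_zero_object C N"
  unfolding is_zero_object_def by auto

lemma is_kernel_op [simp]: "is_kernel (op_cat C) f g \<longleftrightarrow> is_cokernel C f g"
  unfolding is_kernel_def is_cokernel_def op_cat_simps Hom_op eq_commute[of "src C f" "tgt C g"]
  by (simp only: conj_ac)

lemma is_cokernel_op [simp]: "is_cokernel (op_cat C) g f \<longleftrightarrow> is_kernel C g f"
  unfolding is_kernel_def is_cokernel_def op_cat_simps Hom_op eq_commute[of "src C f" "tgt C g"]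
  by (simp only: conj_ac)

lemma is_pullback_op [simp]: "is_pullback (op_cat C) p f p' f' \<longleftrightarrow> is_pushout C p f p' f'"
  unfolding is_pullback_def is_pushout_def by simp

lemma is_pushout_op [simp]: "is_pushout (op_cat C) p f p' f' \<longleftrightarrow> is_pullback C p f p' f'"
  unfolding is_pullback_def is_pushout_def by simp

lemma is_biproduct_op:
  "is_biproduct (op_cat C) X Z Y iX iZ pX pZ \<longleftrightarrow> is_biproduct C X Z Y pX pZ iX iZ"
  unfolding is_biproduct_def by auto

text \<open>Reversing arrows turns a pair \<open>(f, g)\<close> into \<open>(g, f)\<close>, so the
  opposite of an exact structure is its converse relation.\<close>

lemma inflation_op [simp]: "inflation (D\<inverse>) f \<longleftrightarrow> deflation D f"
  unfolding inflation_def deflation_def by simp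

lemma deflation_op [simp]: "deflation (D\<inverse>) f \<longleftrightarrow> inflation D f"
  unfolding inflation_def deflation_def by simp

lemma conflation_op: "conflation (op_cat C) (D\<inverse>) X Y Z f g \<longleftrightarrow> conflation C D Z Y X g f"
  unfolding conflation_def by auto

text \<open>The dictionary by which duals are obtained: a theorem at \<open>op_cat C\<close>,
  unfolded with these equations, is its own dual over \<open>C\<close>.\<close>

lemmas op_simps = op_cat_simps Hom_op is_iso_op is_zero_object_op is_kernel_op is_cokernel_op
  is_pullback_op is_pushout_op is_biproduct_op inflation_op deflation_op conflation_op

lemma (in additive_category) additive_category_op: "additive_category (op_cat C)"
proof -
  have G: "Hom_group (op_cat C) X Y = Hom_group C Y X" for X Y
    by (simp add: Hom_group_def)
  show ?thesis
  proof (intro additive_category.intro category.intro additive_category_axioms.intro, goal_cases)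
    case (5 f X Y g Z h W)
    then show ?case
      using cmp_assoc[of h W Z g Y f X] by (simp del: Hom_iff)
  next
    case (8 X Y)
    then show ?case
      using Hom_comm_group by (simp add: G)
  next
    case 11
    then show ?case
      using zero_object_exists by simp
  next
    case (12 X Z)
    then show ?case
      using biproduct_exists[of X Z] unfolding is_biproduct_op by simp blast
  qed (auto simp: src_obj tgt_obj)
qed

context additive_category
begin

lemmas category_op = additive_category.axioms(1)[OF additive_category_op]

lemma pushoutI:
  assumes "i \<in> Hom C X Y" "f \<in> Hom C X V" "i' \<in> Hom C V P" "f' \<in> Hom C Y P" "f' \<cdot> i = i' \<cdot> f"
    and "\<And>W u v. \<lbrakk>u \<in> Hom C Y W; v \<in> Hom C V W; u \<cdot> i = v \<cdot> f\<rbrakk>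
      \<Longrightarrow> \<exists>k \<in> Hom C P W. k \<cdot> f' = u \<and> k \<cdot> i' = v"
    and "\<And>W k k'. \<lbrakk>k \<in> Hom C P W; k' \<in> Hom C P W; k \<cdot> f' = k' \<cdot> f'; k \<cdot> i' = k' \<cdot> i'\<rbrakk> \<Longrightarrow> k = k'"
  shows "is_pushout C i f i' f'"
  by (rule category.pullbackI[OF category_op, unfolded op_simps, OF assms])

lemma pushout_factor:
  assumes "is_pushout C i f i' f'" "i \<in> Hom C X Y" "f \<in> Hom C X V" "i' \<in> Hom C V P"
    "u \<in> Hom C Y W" "v \<in> Hom C V W" "u \<cdot> i = v \<cdot> f"
  obtains k where "k \<in> Hom C P W" "k \<cdot> f' = u" "k \<cdot> i' = v"
  by (rule category.pullback_factor[OF category_op, unfolded op_simps, OF assms])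

lemma pushout_unique:
  assumes "is_pushout C i f i' f'" "i' \<in> Hom C V P"
    "k \<in> Hom C P W" "k' \<in> Hom C P W" "k \<cdot> f' = k' \<cdot> f'" "k \<cdot> i' = k' \<cdot> i'"
  shows "k = k'"
  by (rule category.pullback_unique[OF category_op, unfolded op_simps, OF assms])

text \<open>Dualising \<open>splits_of_section\<close> exchanges the two summands, which
  \<open>biproduct_commute\<close> undoes.\<close>

lemma splits_of_retraction:
  assumes "is_cokernel C g f" "f \<in> Hom C X Y" "g \<in> Hom C Y Z" "r \<in> Hom C Y X" "r \<cdot> f = ident C X"
  shows "\<exists>s. is_biproduct C X Z Y f s r g"
  using additive_category.splits_of_section[OF additive_category_op, unfolded op_simps,
      OF assms(1,3,2,4,5)] biproduct_commute by blast

end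

section \<open>Exact structures\<close>

text \<open>The axioms that are visibly self-dual. The two remaining ones concern deflations only; their
  duals have to be derived before one may pass to the opposite category.\<close>

locale kernel_cokernel_class = additive_category C
  for C :: "('o, 'm, 'e) preadditive_cat_scheme" (structure) +
  fixes E :: "('m \<times> 'm) set"
  assumes kernel_cokernel_pair: "(f, g) \<in> E \<Longrightarrow> is_kernel C f g \<and> is_cokernel C g f"
    and iso_closed: "\<lbrakk>conflation C E X Y Z f g; f' \<in> Hom C X' Y'; g' \<in> Hom C Y' Z';
        a \<in> Hom C X X'; b \<in> Hom C Y Y'; c \<in> Hom C Z Z'; is_iso C a; is_iso C b; is_iso C c;
        b \<cdot> f = f' \<cdot> a; c \<cdot> g = g' \<cdot> b\<rbrakk> \<Longrightarrow> (f', g') \<in> E"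
    and pullback_exists: "\<lbrakk>deflation E p; f \<in> arr C; tgt C f = tgt C p\<rbrakk>
        \<Longrightarrow> \<exists>p' f'. is_pullback C p f p' f'"
    and pullback_deflation: "\<lbrakk>deflation E p; is_pullback C p f p' f'\<rbrakk> \<Longrightarrow> deflation E p'"
    and pushout_exists: "\<lbrakk>inflation E i; f \<in> arr C; src C f = src C i\<rbrakk>
        \<Longrightarrow> \<exists>i' f'. is_pushout C i f i' f'"
    and pushout_inflation: "\<lbrakk>inflation E i; is_pushout C i f i' f'\<rbrakk> \<Longrightarrow> inflation E i'"

sublocale exact_structure \<subseteq> kernel_cokernel_class C E
  by unfold_locales
    (fact kernel_cokernel_pair iso_closed pullback_exists pullback_deflation pushout_exists
      pushout_inflation)+

text \<open>Only \<open>iso_closed\<close> needs work: reversing arrows also reverses the three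
  comparison isomorphisms, so the axiom has to be applied to their inverses \<open>a'\<close>,
  \<open>b'\<close>, \<open>c'\<close>, for which the commuting squares must be re-derived.\<close>

lemma (in kernel_cokernel_class) kernel_cokernel_class_op: "kernel_cokernel_class (op_cat C) (E\<inverse>)"
proof (intro kernel_cokernel_class.intro kernel_cokernel_class_axioms.intro, goal_cases)
  case 1
  then show ?case by (rule additive_category_op)
next
  case (2 f g)
  then show ?case
    using kernel_cokernel_pair[of g f] by simp
next
  case (3 X Y Z f g f' X' Y' g' Z' a b c)
  obtain a' where a': "a' \<in> Hom C X X'" "a' \<cdot> a = ident C X'" "a \<cdot> a' = ident C X"
    using 3 isoE[of a X' X] by (auto simp del: Hom_iff)
  obtain b' where b': "b' \<in> Hom C Y Y'" "b' \<cdot> b = ident C Y'" "b \<cdot> b' = ident C Y"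
    using 3 isoE[of b Y' Y] by (auto simp del: Hom_iff)
  obtain c' where c': "c' \<in> Hom C Z Z'" "c' \<cdot> c = ident C Z'" "c \<cdot> c' = ident C Z"
    using 3 isoE[of c Z' Z] by (auto simp del: Hom_iff)
  have c: "conflation C E Z Y X g f" "f \<in> Hom C Y X" "g \<in> Hom C Z Y"
    using 3(1) unfolding conflation_op conflation_def by auto
  have f': "f' \<in> Hom C Y' X'" "g' \<in> Hom C Z' Y'" "a \<in> Hom C X' X" "b \<in> Hom C Y' Y"
    "c \<in> Hom C Z' Z" "f \<cdot> b = a \<cdot> f'" "g \<cdot> c = b \<cdot> g'"
    using 3 by (simp_all del: Hom_iff)
  note [simp] = HomD[OF c(2)] HomD[OF c(3)] HomD[OF f'(1)] HomD[OF f'(2)] HomD[OF f'(3)]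
    HomD[OF f'(4)] HomD[OF f'(5)] HomD[OF a'(1)] HomD[OF b'(1)] HomD[OF c'(1)]
    a'(2,3) b'(2,3) c'(2,3) a'(2,3)[THEN reassoc] b'(2,3)[THEN reassoc]
  have "b' \<cdot> g = b' \<cdot> ((g \<cdot> c) \<cdot> c')"
    by simp
  also have "\<dots> = g' \<cdot> c'"
    by (simp only: f'(7)) simp
  finally have 1: "b' \<cdot> g = g' \<cdot> c'" .
  have "a' \<cdot> f = a' \<cdot> ((f \<cdot> b) \<cdot> b')"
    by simp
  also have "\<dots> = f' \<cdot> b'"
    by (simp only: f'(6)) simp
  finally have 2: "a' \<cdot> f = f' \<cdot> b'" .
  have "is_iso C a'" "is_iso C b'" "is_iso C c'"
    using isoI[OF a'(1) f'(3) a'(3,2)] isoI[OF b'(1) f'(4) b'(3,2)] isoI[OF c'(1) f'(5) c'(3,2)]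
    by blast+
  then have "(g', f') \<in> E"
    using iso_closed[OF c(1) f'(2,1) c'(1) b'(1) a'(1) _ _ _ 1 2] by blast
  then show ?case
    by simp
qed (use pullback_exists pullback_deflation pushout_exists pushout_inflation in auto)

section \<open>Consequences of the self-dual axioms: base change and cancellation\<close>

context kernel_cokernel_class
begin

lemma conflationD:
  assumes "conflation C E X Y Z f g"
  shows "f \<in> Hom C X Y" "g \<in> Hom C Y Z" "is_kernel C f g" "is_cokernel C g f" "(f, g) \<in> E"
    "inflation E f" "deflation E g" "g \<cdot> f = \<zero> X Z"
  using assms kernel_cokernel_pair[of f g] kernel_zero[of f g X Y Z]
  unfolding conflation_def inflation_def deflation_def by auto

lemma inflation_conflation:
  assumes "inflation E f" "f \<in> Hom C X Y"
  obtains Z g where "conflation C E X Y Z f g"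
proof -
  obtain g where g: "(f, g) \<in> E"
    using assms unfolding inflation_def by blast
  then have "conflation C E X Y (tgt C g) f g"
    using kernel_cokernel_pair[OF g] assms(2) unfolding conflation_def is_kernel_def by simp
  then show ?thesis
    using that by blast
qed

lemma inflation_arr: "inflation E f \<Longrightarrow> f \<in> arr C"
  using kernel_cokernel_pair unfolding inflation_def is_kernel_def by blast

lemma deflation_conflation:
  assumes "deflation E g" "g \<in> Hom C Y Z"
  obtains X f where "conflation C E X Y Z f g"
proof -
  obtain f where f: "(f, g) \<in> E"
    using assms unfolding deflation_def by blast
  then have "conflation C E (src C f) Y Z f g"
    using kernel_cokernel_pair[OF f] assms(2) unfolding conflation_def is_kernel_def by simp
  then show ?thesis
    using that by blast
qed

text \<open>Two kernels of the same arrow differ by a comparison isomorphism \<open>a\<close>, and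
  \<open>E\<close> is closed under isomorphism of pairs. Hence showing that an arrow is a deflation
  suffices, whichever kernel is at hand.\<close>

lemma deflation_kernel_conflation:
  assumes "deflation E g" "is_kernel C f g" "f \<in> Hom C X Y" "g \<in> Hom C Y Z"
  shows "conflation C E X Y Z f g"
proof -
  obtain X' f' where c: "conflation C E X' Y Z f' g"
    using deflation_conflation[OF assms(1,4)] .
  note c = c conflationD[OF c]
  obtain a where a: "a \<in> Hom C X' X" "f \<cdot> a = f'"
    using kernel_factor[OF assms(2-4) c(2,9)] .
  obtain b where b: "b \<in> Hom C X X'" "f' \<cdot> b = f"
    using kernel_factor[OF c(4,2,3) assms(3) kernel_zero[OF assms(2-4)]] .
  note [simp] = HomD[OF assms(3)] HomD[OF assms(4)] HomD[OF c(2)] HomD[OF a(1)] HomD[OF b(1)]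
    a(2) a(2)[THEN reassoc] b(2) b(2)[THEN reassoc]
  have "b \<cdot> a = ident C X'"
    by (rule kernel_mono[OF c(4,2,3), of _ X']) auto
  moreover have "a \<cdot> b = ident C X"
    by (rule kernel_mono[OF assms(2-4), of _ X]) auto
  ultimately have "is_iso C a"
    by (intro isoI[OF a(1) b(1)])
  then have "(f, g) \<in> E"
    using iso_closed[OF c(1) assms(3,4) a(1), of "ident C Y" "ident C Z"] is_iso_ident by simp
  then show ?thesis
    by (simp add: conflation_def)
qed

lemma inflation_cokernel_conflation:
  assumes "inflation E f" "is_cokernel C g f" "f \<in> Hom C X Y" "g \<in> Hom C Y Z"
  shows "conflation C E X Y Z f g"
  by (rule kernel_cokernel_class.deflation_kernel_conflation[OF kernel_cokernel_class_op,
      unfolded op_simps, OF assms(1,2,4,3)])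

text \<open>Pulling back does not change the kernel: the pair \<open>f\<close>, zero induces
  \<open>f'\<close>, and an arrow killed by \<open>g'\<close> is determined by its image under
  \<open>h'\<close>, which lies in the kernel of \<open>g\<close>.\<close>

lemma pullback_conflation:
  assumes "conflation C E X Y Z f g" "h \<in> Hom C Z' Z"
  obtains Y' f' g' h' where "conflation C E X Y' Z' f' g'" "h' \<in> Hom C Y' Y" "h' \<cdot> f' = f"
    "g \<cdot> h' = h \<cdot> g'" "is_pullback C g h g' h'"
proof -
  note c = conflationD[OF assms(1)]
  note [simp] = HomD[OF c(1)] HomD[OF c(2)] HomD[OF assms(2)] c(8) c(8)[THEN reassoc]
  obtain g' h' where pb: "is_pullback C g h g' h'"
    using pullback_exists[OF c(7), of h] by auto
  define Y' where "Y' = src C g'"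
  have H: "g' \<in> Hom C Y' Z'" "h' \<in> Hom C Y' Y" "g \<cdot> h' = h \<cdot> g'"
    using pb unfolding is_pullback_def Y'_def by auto
  note [simp] = HomD[OF H(1)] HomD[OF H(2)]
  obtain f' where f': "f' \<in> Hom C X Y'" "h' \<cdot> f' = f" "g' \<cdot> f' = \<zero> X Z'"
    using pullback_factor[OF pb c(2) assms(2) H(1) c(1), of "\<zero> X Z'"] by auto
  note [simp] = HomD[OF f'(1)] f'(2,3) f'(2)[THEN reassoc] f'(3)[THEN reassoc]
  have "is_kernel C f' g'"
  proof (rule kernelI[OF f'(1) H(1) f'(3)])
    fix W u assume u: "u \<in> Hom C W Y'" "g' \<cdot> u = \<zero> W Z'"
    note [simp] = HomD[OF u(1)] u(2)
    have "g \<cdot> (h' \<cdot> u) = \<zero> W Z"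
      using reassoc[OF H(3), of u] by simp
    then obtain k where k: "k \<in> Hom C W X" "f \<cdot> k = h' \<cdot> u"
      using kernel_factor[OF c(3,1,2), of "h' \<cdot> u" W] by auto
    note [simp] = HomD[OF k(1)]
    have "f' \<cdot> k = u"
      by (rule pullback_unique[OF pb H(1), of _ W]) (auto simp: k(2))
    then show "\<exists>k \<in> Hom C W X. f' \<cdot> k = u"
      using k(1) by blast
  next
    fix W k k' assume k: "k \<in> Hom C W X" "k' \<in> Hom C W X" "f' \<cdot> k = f' \<cdot> k'"
    note [simp] = HomD[OF k(1)] HomD[OF k(2)]
    have "h' \<cdot> (f' \<cdot> k) = h' \<cdot> (f' \<cdot> k')"
      by (simp only: k(3))
    then have "f \<cdot> k = f \<cdot> k'"
      by simp
    then show "k = k'"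
      by (rule kernel_mono[OF c(3,1,2) k(1,2)])
  qed
  then have "conflation C E X Y' Z' f' g'"
    using deflation_kernel_conflation[OF pullback_deflation[OF c(7) pb]] f'(1) H(1) by blast
  then show ?thesis
    using that H f' pb by blast
qed

text \<open>A weak form of Quillen's obscure axiom. The kernel \<open>m\<close> of \<open>p \<cdot> d\<close> is the pullback of \<open>k\<close> along
  the deflation \<open>d\<close>; this square is also a pushout, so \<open>k\<close> is an inflation and its cokernel \<open>p\<close> a
  deflation.\<close>

lemma deflation_cancel:
  assumes "deflation E d" "deflation E (p \<cdot> d)" "d \<in> Hom C Q Y" "p \<in> Hom C Y Z" "k \<in> Hom C K Y"
    and ker: "is_kernel C k p" and coker: "is_cokernel C p k"
  shows "deflation E p"
proof -
  note [simp] = HomD[OF assms(3)] HomD[OF assms(4)] HomD[OF assms(5)]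
  note pk [simp] = kernel_zero[OF ker assms(5,4)] kernel_zero[OF ker assms(5,4), THEN reassoc]
  obtain L l where l: "conflation C E L Q Y l d"
    using deflation_conflation[OF assms(1,3)] .
  note l' = conflationD[OF l]
  obtain M m where m: "conflation C E M Q Z m (p \<cdot> d)"
    using deflation_conflation[OF assms(2), of Q Z] by auto
  note m' = conflationD[OF m]
  note [simp] = HomD[OF l'(1)] HomD[OF m'(1)] l'(8)
  have pdm: "p \<cdot> (d \<cdot> m) = \<zero> M Z"
    using m'(8) by simp
  then obtain e where e: "e \<in> Hom C M K" "k \<cdot> e = d \<cdot> m"
    using kernel_factor[OF ker assms(5,4), of "d \<cdot> m" M] by auto
  note [simp] = HomD[OF e(1)]
  have "is_pullback C d k e m"
  proof (rule pullbackI[OF assms(3,5) e(1) m'(1) e(2)[symmetric]])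
    fix W u v assume uv: "u \<in> Hom C W Q" "v \<in> Hom C W K" "d \<cdot> u = k \<cdot> v"
    note [simp] = HomD[OF uv(1)] HomD[OF uv(2)]
    have "(p \<cdot> d) \<cdot> u = \<zero> W Z"
      using uv(3) by simp
    then obtain w where w: "w \<in> Hom C W M" "m \<cdot> w = u"
      using kernel_factor[OF m'(3,1,2) uv(1)] by blast
    note [simp] = HomD[OF w(1)]
    have "k \<cdot> (e \<cdot> w) = k \<cdot> v"
      using reassoc[OF e(2), of w] uv(3) w(2) by simp
    then have "e \<cdot> w = v"
      by - (rule kernel_mono[OF ker assms(5,4), of _ W]; simp)
    then show "\<exists>w \<in> Hom C W M. m \<cdot> w = u \<and> e \<cdot> w = v"
      using w by blast
  next
    fix W w w' assume "w \<in> Hom C W M" "w' \<in> Hom C W M" "m \<cdot> w = m \<cdot> w'"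
    then show "w = w'"
      by (rule kernel_mono[OF m'(3,1,2)])
  qed
  then have "deflation E e"
    by (rule pullback_deflation[OF assms(1)])
  then obtain N n where n: "conflation C E N M K n e"
    using deflation_conflation e(1) by blast
  note n' = conflationD[OF n]
  have "is_pushout C m e k d"
  proof (rule pushoutI[OF m'(1) e(1) assms(5,3) e(2)[symmetric]])
    fix W u v assume uv: "u \<in> Hom C Q W" "v \<in> Hom C K W" "u \<cdot> m = v \<cdot> e"
    note [simp] = HomD[OF uv(1)] HomD[OF uv(2)]
    \<comment> \<open>\<open>u\<close> kills the kernel \<open>l\<close> of \<open>d\<close>, since
      \<open>l\<close> factors through \<open>m\<close> by an arrow \<open>l1\<close> that
      \<open>e\<close> annihilates. So \<open>u\<close> descends along \<open>d\<close>.\<close>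
    have "(p \<cdot> d) \<cdot> l = \<zero> L Z"
      by simp
    then obtain l1 where l1: "l1 \<in> Hom C L M" "m \<cdot> l1 = l"
      using kernel_factor[OF m'(3,1,2) l'(1)] by blast
    note [simp] = HomD[OF l1(1)]
    have "k \<cdot> (e \<cdot> l1) = k \<cdot> \<zero> L K"
      using reassoc[OF e(2), of l1] l1(2) by simp
    then have "e \<cdot> l1 = \<zero> L K"
      by - (rule kernel_mono[OF ker assms(5,4), of _ L]; simp)
    then have "u \<cdot> l = \<zero> L W"
      using reassoc[OF uv(3), of l1] l1(2) by simp
    then obtain w where w: "w \<in> Hom C Y W" "w \<cdot> d = u"
      using cokernel_factor[OF l'(4,1,2) uv(1)] by blast
    note [simp] = HomD[OF w(1)]
    \<comment> \<open>The second equation holds after composing with \<open>e\<close>, which is epic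
      as the cokernel of \<open>n\<close>.\<close>
    have "(w \<cdot> k) \<cdot> e = v \<cdot> e"
      using reassoc[OF w(2), of m] e(2) uv(3) by simp
    then have "w \<cdot> k = v"
      by - (rule cokernel_epi[OF n'(4,1,2), of _ W]; simp)
    then show "\<exists>w \<in> Hom C Y W. w \<cdot> d = u \<and> w \<cdot> k = v"
      using w by blast
  next
    fix W w w' assume "w \<in> Hom C Y W" "w' \<in> Hom C Y W" "w \<cdot> d = w' \<cdot> d"
    then show "w = w'"
      by (rule cokernel_epi[OF l'(4,1,2)])
  qed
  then have "inflation E k"
    by (rule pushout_inflation[OF m'(6)])
  then show ?thesis
    using conflationD(7)[OF inflation_cokernel_conflation[OF _ coker assms(5,4)]] by blast
qed

text \<open>Serves to descend to a smaller exact structure: a conflation of the larger one supplies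
  the kernel-cokernel pair \<open>i\<close>, \<open>p\<close>.\<close>

lemma inflation_cancel:
  assumes "inflation E j" "inflation E (j \<cdot> i)" "j \<in> Hom C Y P" "i \<in> Hom C X Y" "p \<in> Hom C Y Z"
    "is_kernel C i p" "is_cokernel C p i"
  shows "inflation E i"
  by (rule kernel_cokernel_class.deflation_cancel[OF kernel_cokernel_class_op, unfolded op_simps,
      OF assms(1-5,7,6)])

lemma pushout_conflation:
  assumes "conflation C E X Y Z f g" "h \<in> Hom C X X'"
  obtains Y' f' g' h' where "conflation C E X' Y' Z f' g'" "h' \<in> Hom C Y Y'" "g' \<cdot> h' = g"
    "h' \<cdot> f = f' \<cdot> h" "is_pushout C f h f' h'"
  by (rule kernel_cokernel_class.pullback_conflation[OF kernel_cokernel_class_op, unfolded op_simps,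
      OF assms])

text \<open>A diagram chase using only kernel-cokernel pairs. What \<open>p'\<close> kills is killed
  by \<open>c\<close>, so it lifts along \<open>g\<close>; as \<open>g'\<close> is monic the lift is
  killed by \<open>p\<close>, so it lifts along \<open>f\<close>. In the other direction, an arrow
  killing \<open>g \<cdot> f\<close> induces one on \<open>A\<close>, and the pushout property glues
  the two.\<close>

lemma composite_kernel_cokernel:
  assumes "conflation C E X Y A f p" "conflation C E Y Z W g c" "conflation C E A P W g' c'"
    "p' \<in> Hom C Z P" "c' \<cdot> p' = c" "p' \<cdot> g = g' \<cdot> p" "is_pushout C g p g' p'"
  shows "is_kernel C (g \<cdot> f) p'" "is_cokernel C p' (g \<cdot> f)"
proof -
  note f = conflationD[OF assms(1)] and g = conflationD[OF assms(2)]
    and g' = conflationD[OF assms(3)]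
  note [simp] = HomD[OF f(1)] HomD[OF f(2)] HomD[OF g(1)] HomD[OF g(2)] HomD[OF g'(1)]
    HomD[OF g'(2)] HomD[OF assms(4)] f(8) g(8) g'(8) assms(5,6) assms(5,6)[THEN reassoc]
  have gf: "g \<cdot> f \<in> Hom C X Z" and z: "p' \<cdot> (g \<cdot> f) = \<zero> X P"
    by simp_all
  show "is_kernel C (g \<cdot> f) p'"
  proof (rule kernelI[OF gf assms(4) z])
    fix V h assume h: "h \<in> Hom C V Z" "p' \<cdot> h = \<zero> V P"
    note [simp] = HomD[OF h(1)] h(2)
    have "c' \<cdot> (p' \<cdot> h) = c \<cdot> h"
      by (simp del: h(2))
    then have "c \<cdot> h = \<zero> V W"
      by simp
    then obtain k where k: "k \<in> Hom C V Y" "g \<cdot> k = h"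
      using kernel_factor[OF g(3,1,2) h(1)] by blast
    note [simp] = HomD[OF k(1)]
    have "g' \<cdot> (p \<cdot> k) = g' \<cdot> \<zero> V A"
      using reassoc[OF assms(6), of k] k(2) by simp
    then have "p \<cdot> k = \<zero> V A"
      by - (rule kernel_mono[OF g'(3,1,2), of _ V]; simp)
    then obtain l where l: "l \<in> Hom C V X" "f \<cdot> l = k"
      using kernel_factor[OF f(3,1,2) k(1)] by blast
    note [simp] = HomD[OF l(1)]
    have "(g \<cdot> f) \<cdot> l = h"
      using k(2) l(2) by simp
    then show "\<exists>l \<in> Hom C V X. (g \<cdot> f) \<cdot> l = h"
      using l(1) by blast
  next
    fix V k k' assume k: "k \<in> Hom C V X" "k' \<in> Hom C V X" "(g \<cdot> f) \<cdot> k = (g \<cdot> f) \<cdot> k'"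
    note [simp] = HomD[OF k(1)] HomD[OF k(2)]
    have "g \<cdot> (f \<cdot> k) = g \<cdot> (f \<cdot> k')"
      using k(3) by simp
    then have "f \<cdot> k = f \<cdot> k'"
      by - (rule kernel_mono[OF g(3,1,2), of _ V]; simp)
    then show "k = k'"
      by (rule kernel_mono[OF f(3,1,2) k(1,2)])
  qed
  show "is_cokernel C p' (g \<cdot> f)"
  proof (rule cokernelI[OF gf assms(4) z])
    fix V h assume h: "h \<in> Hom C Z V" "h \<cdot> (g \<cdot> f) = \<zero> X V"
    note [simp] = HomD[OF h(1)]
    have "(h \<cdot> g) \<cdot> f = \<zero> X V" "h \<cdot> g \<in> Hom C Y V"
      using h(2) by simp_all
    then obtain k where k: "k \<in> Hom C A V" "k \<cdot> p = h \<cdot> g"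
      using cokernel_factor[OF f(4,1,2)] by blast
    then show "\<exists>l \<in> Hom C P V. l \<cdot> p' = h"
      using pushout_factor[OF assms(7) g(1) f(2) g'(1) h(1) k(1)] by metis
  next
    fix V k k' assume k: "k \<in> Hom C P V" "k' \<in> Hom C P V" "k \<cdot> p' = k' \<cdot> p'"
    note [simp] = HomD[OF k(1)] HomD[OF k(2)]
    have "k \<cdot> (g' \<cdot> p) = (k \<cdot> p') \<cdot> g"
      by simp
    also have "\<dots> = k' \<cdot> (g' \<cdot> p)"
      by (simp only: k(3)) simp
    finally have "(k \<cdot> g') \<cdot> p = (k' \<cdot> g') \<cdot> p"
      by simp
    then have "k \<cdot> g' = k' \<cdot> g'"
      by - (rule cokernel_epi[OF f(4,1,2), of _ V]; simp)
    then show "k = k'"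
      by (rule pushout_unique[OF assms(7) g'(1) k])
  qed
qed

end

section \<open>Keller's redundancy: inflations compose\<close>

context exact_structure
begin

text \<open>The axiom provides \<open>ident C N\<close> as a deflation; being its own kernel it is
  an inflation as well, which is the dual axiom.\<close>

lemma ident_zero_conflation:
  assumes "is_zero_object C N"
  shows "conflation C E N N N (ident C N) (ident C N)"
proof -
  have [simp]: "N \<in> obj C"
    using assms unfolding is_zero_object_def by simp
  have "is_kernel C (ident C N) (ident C N)"
  proof (rule kernelI[of _ N N _ N])
    show "ident C N \<cdot> ident C N = \<zero> N N"
      by (rule zero_object_Hom_eq(1)[OF assms, of _ N]) simp_all
  qed auto
  then show ?thesis
    using deflation_kernel_conflation[OF deflation_ident_zero[OF assms], of _ N N N] by simp
qed

text \<open>The identity of \<open>X\<close> is the pushout of the inflation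
  \<open>ident C N\<close> along the zero arrow from \<open>N\<close> to \<open>X\<close>, hence an
  inflation, and \<open>t\<close> is its cokernel.\<close>

lemma to_zero_deflation:
  assumes "is_zero_object C N" "t \<in> Hom C X N"
  shows "deflation E t"
proof -
  note [simp] = HomD[OF assms(2)]
  note z = zero_object_Hom_eq[OF assms(1)]
  have "is_pushout C (ident C N) (\<zero> N X) (ident C X) (\<zero> N X)"
  proof (rule pushoutI[of _ N N _ X _ X])
    fix W u v assume u: "u \<in> Hom C N W" and v: "v \<in> Hom C X W"
    note [simp] = HomD[OF u] HomD[OF v]
    have "v \<cdot> \<zero> N X = u"
      by (rule z(1)[of _ W]) simp_all
    then show "\<exists>k \<in> Hom C X W. k \<cdot> \<zero> N X = u \<and> k \<cdot> ident C X = v"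
      by (intro bexI[OF _ v]) simp
  qed auto
  then have "inflation E (ident C X)"
    using pushout_inflation conflationD(6)[OF ident_zero_conflation[OF assms(1)]] by blast
  moreover have "is_cokernel C t (ident C X)"
  proof (rule cokernelI[of _ X X _ N])
    show "t \<cdot> ident C X = \<zero> X N"
      by (rule z(2)[of _ X]) simp_all
    fix W h assume h: "h \<in> Hom C X W" "h \<cdot> ident C X = \<zero> X W"
    note [simp] = HomD[OF h(1)]
    show "\<exists>k \<in> Hom C N W. k \<cdot> t = h"
      by (rule bexI[of _ "\<zero> N W"]) (use h(2) in simp_all)
  next
    fix W k k' assume "k \<in> Hom C N W" "k' \<in> Hom C N W"
    then show "k = k'"
      by (rule z(1))
  qed simp_all
  ultimately show ?thesis
    using conflationD(7)[OF inflation_cokernel_conflation[of "ident C X" t X X N]] by simp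
qed

text \<open>\<open>Y\<close> is the pullback of the arrows from \<open>X\<close> and
  \<open>Z\<close> to a zero object, so \<open>pZ\<close> is a pulled back deflation. In particular
  split pairs belong to every exact structure.\<close>

lemma biproduct_conflation:
  assumes "is_biproduct C X Z Y iX iZ pX pZ"
  shows "conflation C E X Y Z iX pZ"
proof -
  obtain N where N: "is_zero_object C N"
    using zero_object_exists by blast
  note b = biproductD[OF assms]
  have [simp]: "N \<in> obj C"
    using N unfolding is_zero_object_def by simp
  note [simp] = HomD[OF b(1)] HomD[OF b(2)] HomD[OF b(3)] HomD[OF b(4)]
  have "is_pullback C (\<zero> X N) (\<zero> Z N) pZ pX"
  proof (rule pullbackI[OF _ _ b(4,3)])
    fix W u v assume "u \<in> Hom C W X" "v \<in> Hom C W Z"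
    then show "\<exists>k \<in> Hom C W Y. pX \<cdot> k = u \<and> pZ \<cdot> k = v"
      using biproduct_pair[OF assms] by blast
  next
    fix W k k' assume "k \<in> Hom C W Y" "k' \<in> Hom C W Y" "pX \<cdot> k = pX \<cdot> k'" "pZ \<cdot> k = pZ \<cdot> k'"
    then show "k = k'"
      by (rule biproduct_Hom_eq[OF assms])
  qed simp_all
  moreover have "deflation E (\<zero> X N)"
    by (rule to_zero_deflation[OF N, of _ X]) simp
  ultimately have "deflation E pZ"
    using pullback_deflation by blast
  then show ?thesis
    by (rule deflation_kernel_conflation[OF _ biproduct_kernel[OF assms] b(1,4)])
qed

text \<open>With \<open>P\<close> the pushout of \<open>Z\<close> and \<open>A\<close> under \<open>Y\<close>, the map \<open>Z \<oplus> Y \<rightarrow> P\<close> factors both as the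
  composite of the deflations \<open>1 \<oplus> p\<close> and \<open>(p', g')\<close> (each a pullback of a given deflation) and
  as \<open>p'\<close> after the split deflation \<open>(1, g)\<close>; the latter can be cancelled.\<close>

lemma composite_conflation:
  assumes "conflation C E X Y A f p" "conflation C E Y Z W g c" "conflation C E A P W g' c'"
    "p' \<in> Hom C Z P" "c' \<cdot> p' = c" "p' \<cdot> g = g' \<cdot> p" "is_pushout C g p g' p'"
  shows "conflation C E X Z P (g \<cdot> f) p'"
proof -
  note f = conflationD[OF assms(1)] and g = conflationD[OF assms(2)]
    and g' = conflationD[OF assms(3)]
  note [simp] = HomD[OF f(1)] HomD[OF f(2)] HomD[OF g(1)] HomD[OF g(2)] HomD[OF g'(1)]
    HomD[OF g'(2)] HomD[OF assms(4)] f(8) g(8) g'(8) g'(8)[THEN reassoc]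
    assms(5,6) assms(5,6)[THEN reassoc]
  have "Z \<in> obj C" "A \<in> obj C"
    by simp_all
  then obtain B iZ iA qZ qA where "is_biproduct C Z A B iZ iA qZ qA"
    by (rule biproduct_objects)
  note B = this biproductD[OF this]
  note [simp] = HomD[OF B(2)] HomD[OF B(3)] HomD[OF B(4)] HomD[OF B(5)] B(6-9)
    B(6-9)[THEN reassoc]
  define \<phi> where "\<phi> = p' \<cdot> qZ \<oplus> g' \<cdot> qA"
  have \<phi>: "\<phi> \<in> Hom C B P"
    unfolding \<phi>_def by simp
  note [simp] = HomD[OF \<phi>]
  have \<phi>_cmp: "\<phi> \<cdot> k = p' \<cdot> (qZ \<cdot> k) \<oplus> g' \<cdot> (qA \<cdot> k)" if "k \<in> Hom C V B" for V k
    unfolding \<phi>_def using HomD[OF that] by simp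
  have "is_pullback C c c' \<phi> qZ"
  proof (rule pullbackI[OF g(2) g'(2) \<phi> B(4)])
    show "c \<cdot> qZ = c' \<cdot> \<phi>"
      unfolding \<phi>_def by simp
  next
    fix V u v assume uv: "u \<in> Hom C V Z" "v \<in> Hom C V P" "c \<cdot> u = c' \<cdot> v"
    note [simp] = HomD[OF uv(1)] HomD[OF uv(2)]
    \<comment> \<open>\<open>d\<close> is \<open>v\<close> minus \<open>p' \<cdot> u\<close>. Both
      have the same composite with \<open>c'\<close>, so \<open>d\<close> comes from
      \<open>A\<close> and gives the second coordinate of the lift.\<close>
    obtain d where d: "d \<in> Hom C V P" "d \<oplus> p' \<cdot> u = v"
      using difference[of v V P "p' \<cdot> u"] uv by auto
    note [simp] = HomD[OF d(1)]
    have "c' \<cdot> (d \<oplus> p' \<cdot> u) = c \<cdot> u"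
      by (simp only: d(2) uv(3))
    then have "c' \<cdot> d \<oplus> c \<cdot> u = c \<cdot> u"
      by simp
    then have "c' \<cdot> d = \<zero> V W"
      by (rule plus_eq_right_iff_zero) simp_all
    then obtain k where k: "k \<in> Hom C V A" "g' \<cdot> k = d"
      using kernel_factor[OF g'(3,1,2) d(1)] by blast
    note [simp] = HomD[OF k(1)] k(2)
    note pr = biproduct_pair[OF B(1) uv(1) k(1)]
    have "\<phi> \<cdot> (iZ \<cdot> u \<oplus> iA \<cdot> k) = p' \<cdot> u \<oplus> d"
      by (simp only: \<phi>_cmp[OF pr(1)] pr(2,3) k(2))
    also have "\<dots> = v"
      using plus_comm[of "p' \<cdot> u" V P d] d(2) by simp
    finally show "\<exists>k \<in> Hom C V B. qZ \<cdot> k = u \<and> \<phi> \<cdot> k = v"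
      using pr by blast
  next
    fix V k k' assume k: "k \<in> Hom C V B" "k' \<in> Hom C V B" "qZ \<cdot> k = qZ \<cdot> k'" "\<phi> \<cdot> k = \<phi> \<cdot> k'"
    note [simp] = HomD[OF k(1)] HomD[OF k(2)]
    have "p' \<cdot> (qZ \<cdot> k') \<oplus> g' \<cdot> (qA \<cdot> k) = p' \<cdot> (qZ \<cdot> k') \<oplus> g' \<cdot> (qA \<cdot> k')"
      using k(4) unfolding \<phi>_cmp[OF k(1)] \<phi>_cmp[OF k(2)] k(3) .
    then have "g' \<cdot> (qA \<cdot> k) \<oplus> p' \<cdot> (qZ \<cdot> k') = g' \<cdot> (qA \<cdot> k') \<oplus> p' \<cdot> (qZ \<cdot> k')"
      using plus_comm[of "p' \<cdot> (qZ \<cdot> k')" V P] by simp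
    then have "g' \<cdot> (qA \<cdot> k) = g' \<cdot> (qA \<cdot> k')"
      by (rule plus_right_cancel[of _ _ _ V P]) simp_all
    then have "qA \<cdot> k = qA \<cdot> k'"
      by - (rule kernel_mono[OF g'(3,1,2), of _ V]; simp)
    then show "k = k'"
      by (rule biproduct_Hom_eq[OF B(1) k(1-3)])
  qed
  then have \<phi>_defl: "deflation E \<phi>"
    by (rule pullback_deflation[OF g(7)])
  have "Z \<in> obj C" "Y \<in> obj C"
    by simp_all
  then obtain R jZ jY rZ rY where "is_biproduct C Z Y R jZ jY rZ rY"
    by (rule biproduct_objects)
  note R = this biproductD[OF this]
  note [simp] = HomD[OF R(2)] HomD[OF R(3)] HomD[OF R(4)] HomD[OF R(5)] R(6-9)
    R(6-9)[THEN reassoc]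
  define q where "q = iZ \<cdot> rZ \<oplus> iA \<cdot> (p \<cdot> rY)"
  have q: "q \<in> Hom C R B" "qZ \<cdot> q = rZ" "qA \<cdot> q = p \<cdot> rY"
    unfolding q_def by simp_all
  note [simp] = HomD[OF q(1)] q(2,3) q(2,3)[THEN reassoc]
  have "is_pullback C p qA q rY"
  proof (rule pullbackI[OF f(2) B(5) q(1) R(5) q(3)[symmetric]])
    fix V u v assume uv: "u \<in> Hom C V Y" "v \<in> Hom C V B" "p \<cdot> u = qA \<cdot> v"
    note [simp] = HomD[OF uv(1)] HomD[OF uv(2)]
    have qv: "qZ \<cdot> v \<in> Hom C V Z"
      by simp
    note pr = biproduct_pair[OF R(1) qv uv(1)]
    have "q \<cdot> (jZ \<cdot> (qZ \<cdot> v) \<oplus> jY \<cdot> u) = v"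
      by (rule biproduct_Hom_eq[OF B(1) _ uv(2)]) (use uv(3) in simp_all)
    then show "\<exists>k \<in> Hom C V R. rY \<cdot> k = u \<and> q \<cdot> k = v"
      using pr by blast
  next
    fix V k k' assume k: "k \<in> Hom C V R" "k' \<in> Hom C V R" "rY \<cdot> k = rY \<cdot> k'" "q \<cdot> k = q \<cdot> k'"
    note [simp] = HomD[OF k(1)] HomD[OF k(2)]
    have "qZ \<cdot> (q \<cdot> k) = qZ \<cdot> (q \<cdot> k')"
      by (simp only: k(4))
    then have "rZ \<cdot> k = rZ \<cdot> k'"
      by simp
    then show "k = k'"
      by (rule biproduct_Hom_eq[OF R(1) k(1,2) _ k(3)])
  qed
  then have "deflation E q"
    by (rule pullback_deflation[OF f(7)])
  then have \<phi>q: "deflation E (\<phi> \<cdot> q)"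
    using \<phi>_defl by (rule deflation_cmp) simp
  define e where "e = rZ \<oplus> g \<cdot> rY"
  have e: "e \<in> Hom C R Z" "e \<cdot> jZ = ident C Z"
    unfolding e_def by simp_all
  have "\<phi> \<cdot> q = p' \<cdot> e"
    unfolding \<phi>_def e_def by simp
  then have p'e: "deflation E (p' \<cdot> e)"
    using \<phi>q by simp
  \<comment> \<open>\<open>j\<close> is \<open>jY\<close> minus \<open>jZ \<cdot> g\<close>, the
    graph of \<open>-g\<close>, which \<open>e\<close> kills. Replacing \<open>jY\<close> by
    \<open>j\<close> and \<open>rZ\<close> by \<open>e\<close> shears the biproduct \<open>R\<close>
    into another one of \<open>Y\<close> and \<open>Z\<close>, now with \<open>e\<close> as a
    projection.\<close>
  obtain j where j: "j \<in> Hom C Y R" "j \<oplus> jZ \<cdot> g = jY"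
    using difference[of jY Y R "jZ \<cdot> g"] by auto
  note [simp] = HomD[OF j(1)]
  have "rY \<cdot> (j \<oplus> jZ \<cdot> g) = ident C Y"
    by (simp only: j(2)) simp
  then have rYj: "rY \<cdot> j = ident C Y"
    by simp
  have "rZ \<cdot> (j \<oplus> jZ \<cdot> g) = \<zero> Y Z"
    by (simp only: j(2)) simp
  then have rZj: "rZ \<cdot> j \<oplus> g = \<zero> Y Z"
    by simp
  have ej: "e \<cdot> j = \<zero> Y Z"
    unfolding e_def by (simp add: rYj rZj)
  have "j \<cdot> rY \<oplus> jZ \<cdot> e = j \<cdot> rY \<oplus> (jZ \<cdot> (g \<cdot> rY) \<oplus> jZ \<cdot> rZ)"
    unfolding e_def using plus_comm[of "jZ \<cdot> (g \<cdot> rY)" R R "jZ \<cdot> rZ"] by simp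
  also have "\<dots> = (j \<oplus> jZ \<cdot> g) \<cdot> rY \<oplus> jZ \<cdot> rZ"
    using plus_assoc[of "j \<cdot> rY" R R "jZ \<cdot> (g \<cdot> rY)" "jZ \<cdot> rZ"] by simp
  also have "\<dots> = ident C R"
    using j(2) R(10) plus_comm[of "jZ \<cdot> rZ" R R "jY \<cdot> rY"] by simp
  finally have "is_biproduct C Y Z R j jZ rY e"
    unfolding is_biproduct_def using R(2-9) e j(1) rYj ej by simp
  then have "deflation E e"
    using biproduct_conflation conflationD(7) by blast
  then have "deflation E p'"
    using deflation_cancel[OF _ p'e e(1) assms(4) _ composite_kernel_cokernel[OF assms]] by simp
  then show ?thesis
    using deflation_kernel_conflation[OF _ composite_kernel_cokernel(1)[OF assms], of X Z P] by simp
qed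

text \<open>Pushing \<open>g\<close> out along the cokernel \<open>p\<close> of \<open>f\<close>
  yields the object \<open>P\<close> that serves as the cokernel of the composite.\<close>

lemma inflation_cmp:
  assumes "inflation E f" "inflation E g" "f \<in> Hom C X Y" "g \<in> Hom C Y Z"
  shows "inflation E (g \<cdot> f)"
proof -
  obtain A p where f: "conflation C E X Y A f p"
    using inflation_conflation[OF assms(1,3)] .
  obtain W c where g: "conflation C E Y Z W g c"
    using inflation_conflation[OF assms(2,4)] .
  show ?thesis
    using pushout_conflation[OF g conflationD(2)[OF f]] composite_conflation[OF f g] conflationD(6)
    by metis
qed

lemma exact_structure_op: "exact_structure (op_cat C) (E\<inverse>)"
proof -
  interpret op: kernel_cokernel_class "op_cat C" "E\<inverse>"
    by (rule kernel_cokernel_class_op)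
  show ?thesis
  proof (intro exact_structure.intro exact_structure_axioms.intro additive_category_op, goal_cases)
    case (3 N)
    then show ?case
      using conflationD(6)[OF ident_zero_conflation] by simp
  next
    case (4 p q)
    then show ?case
      using inflation_cmp[of q p "src C q" "tgt C q" "tgt C p"] inflation_arr by simp
  qed (fact op.kernel_cokernel_pair op.iso_closed op.pullback_exists op.pullback_deflation
      op.pushout_exists op.pushout_inflation)+
qed

end

section \<open>Cotorsion pairs\<close>

lemma (in additive_category) splits_op: "splits (op_cat C) X Y Z f g \<longleftrightarrow> splits C Z Y X g f"
  unfolding splits_def is_biproduct_op using biproduct_commute by blast

lemma (in additive_category) Ext1_vanishes_op:
  "Ext1_vanishes (op_cat C) (D\<inverse>) Z X \<longleftrightarrow> Ext1_vanishes C D X Z"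
  unfolding Ext1_vanishes_def conflation_op splits_op by blast

lemma (in additive_category) cotorsion_pair_op:
  "cotorsion_pair (op_cat C) (D\<inverse>) \<B> \<A> \<longleftrightarrow> cotorsion_pair C D \<A> \<B>"
  unfolding cotorsion_pair_def Ext1_vanishes_op op_cat_simps by blast

lemma is_cover_op: "is_cover (op_cat C) (D\<inverse>) \<B> Z X f \<longleftrightarrow> is_envelope C D \<B> Z X f"
  unfolding is_cover_def is_envelope_def is_precover_def is_preenvelope_def by simp

lemma is_envelope_op: "is_envelope (op_cat C) (D\<inverse>) \<A> Z X f \<longleftrightarrow> is_cover C D \<A> Z X f"
  unfolding is_cover_def is_envelope_def is_precover_def is_preenvelope_def by simp

lemma (in additive_category) perfect_cotorsion_pair_op:
  "perfect_cotorsion_pair (op_cat C) (D\<inverse>) \<B> \<A> \<longleftrightarrow> perfect_cotorsion_pair C D \<A> \<B>"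
  unfolding perfect_cotorsion_pair_def cotorsion_pair_op is_cover_op is_envelope_op op_cat_simps
  by (simp only: conj_commute)

lemma flat_op: "flat (op_cat C) (D\<inverse>) (E\<inverse>) X \<longleftrightarrow> divisible C D E X"
  unfolding flat_def divisible_def by simp

lemma divisible_wrt_op: "divisible_wrt (op_cat C) (D\<inverse>) (E\<inverse>) \<B> X \<longleftrightarrow> flat_wrt C D E \<B> X"
  unfolding flat_wrt_def divisible_wrt_def by simp

section \<open>Vanishing of Ext and Wakamatsu's lemma\<close>

context exact_structure
begin

lemma Ext1_vanishesI:
  assumes "\<And>Y f g. conflation C E X Y Z f g \<Longrightarrow> \<exists>s \<in> Hom C Z Y. g \<cdot> s = ident C Z"
  shows "Ext1_vanishes C E Z X"
  unfolding Ext1_vanishes_def splits_def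
proof (intro allI impI)
  fix Y f g assume c: "conflation C E X Y Z f g"
  then obtain s where "s \<in> Hom C Z Y" "g \<cdot> s = ident C Z"
    using assms by blast
  then show "\<exists>s r. is_biproduct C X Z Y f s r g"
    using splits_of_section[OF conflationD(3,1,2)[OF c]] by blast
qed

lemma Ext1_section:
  assumes "Ext1_vanishes C E Z X" "conflation C E X Y Z f g"
  obtains s where "s \<in> Hom C Z Y" "g \<cdot> s = ident C Z"
  using assms biproductD unfolding Ext1_vanishes_def splits_def by meson

lemma Ext1_retraction:
  assumes "Ext1_vanishes C E Z X" "conflation C E X Y Z f g"
  obtains r where "r \<in> Hom C Y X" "r \<cdot> f = ident C X"
  using assms biproductD unfolding Ext1_vanishes_def splits_def by meson

text \<open>The obstruction to extending \<open>h\<close> along \<open>f\<close> is the pushout of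
  the conflation along \<open>h\<close>, an extension of \<open>Z\<close> by \<open>B\<close>. A
  retraction of it, composed with \<open>h'\<close>, is the extension sought.\<close>

lemma Ext1_extend:
  assumes "Ext1_vanishes C E Z B" "conflation C E X Y Z f g" "h \<in> Hom C X B"
  obtains v where "v \<in> Hom C Y B" "v \<cdot> f = h"
proof -
  obtain P f' g' h' where p: "conflation C E B P Z f' g'" "h' \<in> Hom C Y P" "g' \<cdot> h' = g"
      "h' \<cdot> f = f' \<cdot> h" "is_pushout C f h f' h'"
    using pushout_conflation[OF assms(2,3)] .
  obtain r where r: "r \<in> Hom C P B" "r \<cdot> f' = ident C B"
    using Ext1_retraction[OF assms(1) p(1)] .
  note [simp] = HomD[OF conflationD(1)[OF assms(2)]] HomD[OF conflationD(1)[OF p(1)]]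
    HomD[OF p(2)] HomD[OF r(1)] HomD[OF assms(3)] p(4) r(2) r(2)[THEN reassoc]
  show ?thesis
    by (rule that[of "r \<cdot> h'"]) simp_all
qed

text \<open>Exactness of Ext in the middle, done by hand because only vanishing is defined. An
  extension \<open>T\<close> of \<open>A\<close> by \<open>Y\<close> is pushed out to one by
  \<open>Z\<close>, which has a section; pulling back along that section leaves an extension by
  \<open>X\<close>, whose section gives one of \<open>T\<close>.\<close>

lemma Ext1_vanishes_extension:
  assumes "conflation C E X Y Z f g" "Ext1_vanishes C E A X" "Ext1_vanishes C E A Z"
  shows "Ext1_vanishes C E A Y"
proof (rule Ext1_vanishesI)
  fix T m b assume T: "conflation C E Y T A m b"
  obtain P m' b' q where P: "conflation C E Z P A m' b'" "q \<in> Hom C T P" "b' \<cdot> q = b"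
    "q \<cdot> m = m' \<cdot> g" "is_pushout C m g m' q"
    using pushout_conflation[OF T conflationD(2)[OF assms(1)]] .
  \<comment> \<open>The comparison \<open>q\<close> is a deflation with kernel \<open>X\<close>, so
    it can be pulled back along the section \<sigma>.\<close>
  have c: "conflation C E X T P (m \<cdot> f) q"
    by (rule composite_conflation[OF assms(1) T P])
  obtain \<sigma> where \<sigma>: "\<sigma> \<in> Hom C A P" "b' \<cdot> \<sigma> = ident C A"
    using Ext1_section[OF assms(3) P(1)] .
  obtain Q f1 g1 h where Q: "conflation C E X Q A f1 g1" "h \<in> Hom C Q T" "h \<cdot> f1 = m \<cdot> f"
      "q \<cdot> h = \<sigma> \<cdot> g1" "is_pullback C q \<sigma> g1 h"
    using pullback_conflation[OF c \<sigma>(1)] .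
  obtain \<tau> where \<tau>: "\<tau> \<in> Hom C A Q" "g1 \<cdot> \<tau> = ident C A"
    using Ext1_section[OF assms(2) Q(1)] .
  note [simp] = HomD[OF conflationD(2)[OF T]] HomD[OF conflationD(2)[OF P(1)]] HomD[OF P(2)]
    HomD[OF \<sigma>(1)] HomD[OF Q(2)] HomD[OF \<tau>(1)] HomD[OF conflationD(2)[OF Q(1)]]
  have "b \<cdot> (h \<cdot> \<tau>) = (b' \<cdot> q) \<cdot> (h \<cdot> \<tau>)"
    by (simp only: P(3))
  also have "\<dots> = b' \<cdot> ((q \<cdot> h) \<cdot> \<tau>)"
    by simp
  also have "\<dots> = (b' \<cdot> \<sigma>) \<cdot> (g1 \<cdot> \<tau>)"
    by (simp only: Q(4)) simp
  also have "\<dots> = ident C A"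
    by (simp only: \<sigma>(2) \<tau>(2)) simp
  finally show "\<exists>s \<in> Hom C A T. b \<cdot> s = ident C A"
    by (intro bexI[of _ "h \<cdot> \<tau>"]) simp_all
qed

lemma Ext1_vanishes_extension_left:
  assumes "conflation C E X Y Z f g" "Ext1_vanishes C E X B" "Ext1_vanishes C E Z B"
  shows "Ext1_vanishes C E Y B"
  using exact_structure.Ext1_vanishes_extension[OF exact_structure_op,
      unfolded conflation_op Ext1_vanishes_op, OF assms(1,3,2)] .

text \<open>Wakamatsu's lemma.\<close>

lemma envelope_cokernel:
  assumes "cotorsion_pair C E \<A> \<B>" "is_envelope C E \<B> X B f" "conflation C E X B A f g"
  shows "A \<in> \<A>"
proof -
  note f = conflationD[OF assms(3)]
  have BD: "B \<in> \<B>" and pre: "\<And>X' h. \<lbrakk>X' \<in> \<B>; h \<in> Hom C X X'\<rbrakk> \<Longrightarrow> \<exists>k \<in> Hom C B X'. k \<cdot> f = h"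
    and iso: "\<And>k. \<lbrakk>k \<in> Hom C B B; k \<cdot> f = f\<rbrakk> \<Longrightarrow> is_iso C k"
    using assms(2) unfolding is_envelope_def is_preenvelope_def by blast+
  have \<A>: "\<A> = {X \<in> obj C. \<forall>B \<in> \<B>. Ext1_vanishes C E X B}"
    and \<B>: "\<B> = {X \<in> obj C. \<forall>A \<in> \<A>. Ext1_vanishes C E A X}"
    using assms(1) unfolding cotorsion_pair_def by blast+
  note [simp] = HomD[OF f(1)] HomD[OF f(2)] f(8)
  have "Ext1_vanishes C E A B'" if B': "B' \<in> \<B>" for B'
  proof (rule Ext1_vanishesI)
    fix Y i p assume c: "conflation C E B' Y A i p"
    obtain Y' i' q t where c': "conflation C E B' Y' B i' q" and t: "t \<in> Hom C Y' Y"
      and pt: "p \<cdot> t = g \<cdot> q" and pb: "is_pullback C p g q t"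
      using pullback_conflation[OF c f(2)] .
    note p = conflationD(2)[OF c] and q = conflationD(2)[OF c']
    note [simp] = HomD[OF p] HomD[OF q] HomD[OF t]
    \<comment> \<open>\<open>Y'\<close> is an extension of \<open>B\<close> by \<open>B'\<close>,
      hence in \<B>, so arrows from \<open>X\<close> to it factor through the envelope.\<close>
    have "Ext1_vanishes C E A' Y'" if "A' \<in> \<A>" for A'
      using Ext1_vanishes_extension[OF c'] B' BD that \<B> by blast
    then have "Y' \<in> \<B>"
      by (subst \<B>) simp
    \<comment> \<open>Since \<open>g \<cdot> f\<close> vanishes, zero and \<open>f\<close> agree
      over \<open>A\<close>: \<open>f\<close> lifts to the pullback by an arrow that dies in
      \<open>Y\<close>.\<close>
    obtain j where j: "j \<in> Hom C X Y'" "t \<cdot> j = \<zero> X Y" "q \<cdot> j = f"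
      by (rule pullback_factor[OF pb p f(2) q, of "\<zero> X Y" X f]) simp_all
    obtain h where h: "h \<in> Hom C B Y'" "h \<cdot> f = j"
      using pre[OF \<open>Y' \<in> \<B>\<close> j(1)] by blast
    note [simp] = HomD[OF j(1)] HomD[OF h(1)] j(2,3) h(2)
    \<comment> \<open>\<open>q \<cdot> h\<close> fixes \<open>f\<close>, so minimality makes it
      invertible, and its inverse \<open>w\<close> fixes \<open>f\<close> too.\<close>
    have "is_iso C (q \<cdot> h)" "q \<cdot> h \<in> Hom C B B"
      using iso[of "q \<cdot> h"] by simp_all
    then obtain w where w: "w \<in> Hom C B B" "w \<cdot> (q \<cdot> h) = ident C B" "(q \<cdot> h) \<cdot> w = ident C B"
      by (rule isoE)
    note [simp] = HomD[OF w(1)]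
    have "w \<cdot> f = (w \<cdot> (q \<cdot> h)) \<cdot> f"
      by simp
    also have "\<dots> = f"
      by (simp only: w(2)) simp
    finally have [simp]: "w \<cdot> f = f" .
    \<comment> \<open>\<open>h \<cdot> w\<close> is a section of \<open>q\<close> restricting to
      \<open>j\<close> on \<open>X\<close>. As \<open>t\<close> kills \<open>j\<close>, its image in
      \<open>Y\<close> descends to the cokernel \<open>A\<close> as the desired section
      \<open>s\<close>.\<close>
    have "t \<cdot> (h \<cdot> w) \<in> Hom C B Y" "(t \<cdot> (h \<cdot> w)) \<cdot> f = \<zero> X Y"
      by simp_all
    then obtain s where s: "s \<in> Hom C A Y" "s \<cdot> g = t \<cdot> (h \<cdot> w)"
      using cokernel_factor[OF f(4,1,2)] by blast
    note [simp] = HomD[OF s(1)]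
    have "(p \<cdot> s) \<cdot> g = (p \<cdot> t) \<cdot> (h \<cdot> w)"
      using s(2) by simp
    also have "\<dots> = g \<cdot> ((q \<cdot> h) \<cdot> w)"
      by (simp only: pt) simp
    also have "\<dots> = ident C A \<cdot> g"
      by (simp only: w(3)) simp
    finally have "p \<cdot> s = ident C A"
      by - (rule cokernel_epi[OF f(4,1,2), of _ A]; simp)
    then show "\<exists>s \<in> Hom C A Y. p \<cdot> s = ident C A"
      using s(1) by blast
  qed
  then show ?thesis
    by (subst \<A>) simp
qed

end

section \<open>Relative divisibility\<close>

locale exact_substructure = exact_structure C D + E: exact_structure C E
  for C :: "('o, 'm, 'e) preadditive_cat_scheme" (structure) and D E +
  assumes substructure: "E \<subseteq> D"
begin

lemma conflation_mono: "conflation C E X Y Z f g \<Longrightarrow> conflation C D X Y Z f g"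
  using substructure unfolding conflation_def by blast

text \<open>Pulling a \<open>D\<close>-deflation \<open>p\<close> onto \<open>Z\<close> back along
  \<open>d\<close> gives one onto the flat object \<open>A\<close>, hence an
  \<open>E\<close>-deflation \<open>p'\<close>. So \<open>d \<cdot> p' = p \<cdot> d'\<close> is an
  \<open>E\<close>-deflation, and so is \<open>d'\<close> as a pullback of \<open>d\<close>;
  cancelling \<open>d'\<close> leaves \<open>p\<close>.\<close>

lemma flat_quotient:
  assumes "conflation C E K A Z k d" "flat C D E A"
  shows "flat C D E Z"
  unfolding flat_def
proof (intro conjI ballI impI)
  note d = E.conflationD[OF assms(1)]
  show "Z \<in> obj C"
    using HomD[OF d(2)] by blast
  fix Y p assume p: "p \<in> Hom C Y Z" "deflation D p"
  obtain L l where l: "conflation C D L Y Z l p"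
    using deflation_conflation[OF p(2,1)] .
  obtain Q l' p' d' where Q: "conflation C D L Q A l' p'" and d': "d' \<in> Hom C Q Y"
    and sq: "p \<cdot> d' = d \<cdot> p'" and pb: "is_pullback C p d p' d'"
    using pullback_conflation[OF l d(2)] .
  note p' = conflationD(2)[OF Q]
  have "deflation E p'"
    using assms(2) conflationD(7)[OF Q] p' HomD(4)[OF p'] unfolding flat_def by blast
  moreover have "tgt C p' = src C d"
    using HomD[OF p'] HomD[OF d(2)] by simp
  ultimately have "deflation E (p \<cdot> d')"
    unfolding sq using E.deflation_cmp d(7) by blast
  moreover have "deflation E d'"
    using E.pullback_deflation[OF d(7) pullback_sym[OF pb]] .
  ultimately show "deflation E p"
    using E.deflation_cancel[OF _ _ d' p(1) conflationD(1,3,4)[OF l]] by blast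
qed

lemma envelope_conflation:
  assumes "cotorsion_pair C D \<A> \<B>" "\<A> = {X. flat C D E X}" "is_envelope C D \<B> X B f"
  obtains A g where "conflation C E X B A f g" "A \<in> \<A>"
proof -
  have f: "f \<in> Hom C X B" "inflation D f"
    using assms(3) unfolding is_envelope_def is_preenvelope_def by blast+
  obtain A g where g: "conflation C D X B A f g"
    using inflation_conflation[OF f(2,1)] .
  note g' = conflationD[OF g]
  have A: "A \<in> \<A>"
    by (rule envelope_cokernel[OF assms(1,3) g])
  then have "deflation E g"
    using assms(2) g'(2,7) HomD(4)[OF g'(2)] unfolding flat_def by blast
  then have "conflation C E X B A f g"
    by (rule E.deflation_kernel_conflation[OF _ g'(3,1,2)])
  then show ?thesis
    using that A by blast
qed

text \<open>The envelope property splits every \<open>D\<close>-inflation of \<open>B\<close> into an object of \<open>\<A>\<close>: the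
  composite with \<open>f\<close> is an \<open>E\<close>-inflation with flat cokernel, so \<open>f\<close> extends along it.\<close>

lemma envelope_divisible_wrt:
  assumes "cotorsion_pair C D \<A> \<B>" "\<A> = {X. flat C D E X}" "is_envelope C D \<B> X B f"
    "divisible_wrt C D E \<A> X"
  shows "divisible_wrt C D E \<A> B"
  unfolding divisible_wrt_def
proof (intro conjI ballI impI)
  have f: "f \<in> Hom C X B" "inflation D f" and "B \<in> \<B>"
    and iso: "\<And>k. \<lbrakk>k \<in> Hom C B B; k \<cdot> f = f\<rbrakk> \<Longrightarrow> is_iso C k"
    using assms(3) unfolding is_envelope_def is_preenvelope_def by blast+
  note [simp] = HomD[OF f(1)]
  show "B \<in> obj C"
    by simp
  fix A u assume A: "A \<in> \<A>" and u: "u \<in> Hom C B A" "inflation D u"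
  note [simp] = HomD[OF u(1)]
  have uf: "u \<cdot> f \<in> Hom C X A"
    by simp
  \<comment> \<open>That \<open>u \<cdot> f\<close> is a \<open>D\<close>-inflation already rests on
    the composition of inflations, before any passage to the opposite category.\<close>
  have "inflation E (u \<cdot> f)"
    using assms(4) inflation_cmp[OF f(2) u(2) f(1) u(1)] uf A unfolding divisible_wrt_def by blast
  then obtain Z z where z: "conflation C E X A Z (u \<cdot> f) z"
    using E.inflation_conflation uf by blast
  have "Z \<in> \<A>"
    using flat_quotient[OF z] A assms(2) by blast
  then have "Ext1_vanishes C D Z B"
    using assms(1) \<open>B \<in> \<B>\<close> unfolding cotorsion_pair_def by blast
  then obtain v where v: "v \<in> Hom C A B" "v \<cdot> (u \<cdot> f) = f"
    using Ext1_extend[OF _ conflation_mono[OF z] f(1)] by blast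
  note [simp] = HomD[OF v(1)]
  have "is_iso C (v \<cdot> u)" "v \<cdot> u \<in> Hom C B B"
    using iso[of "v \<cdot> u"] v(2) by simp_all
  then obtain w where w: "w \<in> Hom C B B" "w \<cdot> (v \<cdot> u) = ident C B"
    by (rule isoE)
  note [simp] = HomD[OF w(1)]
  obtain W c where c: "conflation C D B A W u c"
    using inflation_conflation[OF u(2,1)] .
  have "w \<cdot> v \<in> Hom C A B" "(w \<cdot> v) \<cdot> u = ident C B"
    using w(2) by simp_all
  then obtain s where "is_biproduct C B W A u s (w \<cdot> v) c"
    using splits_of_retraction[OF conflationD(4,1,2)[OF c]] by blast
  \<comment> \<open>A split pair is a conflation of every exact structure, so the splitting found
    from \<open>D\<close> serves \<open>E\<close>.\<close>
  then show "inflation E u"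
    using E.conflationD(6)[OF E.biproduct_conflation] by blast
qed

lemma divisible_wrt_of_conflation:
  assumes "cotorsion_pair C D \<A> \<B>" "conflation C E X Y A f g" "A \<in> \<A>"
    "divisible_wrt C D E \<A> Y"
  shows "divisible_wrt C D E \<A> X"
  unfolding divisible_wrt_def
proof (intro conjI ballI impI)
  note f = E.conflationD[OF assms(2)]
  show "X \<in> obj C"
    using HomD[OF f(1)] by blast
  fix A1 u assume A1: "A1 \<in> \<A>" and u: "u \<in> Hom C X A1" "inflation D u"
  have \<A>: "\<A> = {X \<in> obj C. \<forall>B \<in> \<B>. Ext1_vanishes C D X B}"
    using assms(1) unfolding cotorsion_pair_def by blast
  obtain W c where c: "conflation C D X A1 W u c"
    using inflation_conflation[OF u(2,1)] .
  obtain P f' g' u' where P: "conflation C E A1 P A f' g'" and u': "u' \<in> Hom C Y P"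
    and sq: "u' \<cdot> f = f' \<cdot> u" and po: "is_pushout C f u f' u'"
    using E.pushout_conflation[OF assms(2) u(1)] .
  note f' = E.conflationD[OF P]
  have "Ext1_vanishes C D P B" if "B \<in> \<B>" for B
    using Ext1_vanishes_extension_left[OF conflation_mono[OF P]] A1 assms(3) that \<A> by blast
  then have "P \<in> \<A>"
    using HomD(5)[OF u'] by (subst \<A>) simp
  \<comment> \<open>The same square with its legs exchanged: \<open>u'\<close> is the pushout of the
    \<open>D\<close>-inflation \<open>u\<close> along \<open>f\<close>.\<close>
  have "is_pushout C u f u' f'"
    using category.pullback_sym[OF category_op, unfolded op_simps, OF po] .
  then have "inflation D u'"
    using pushout_inflation[OF u(2)] by blast
  then have "inflation E u'"
    using assms(4) \<open>P \<in> \<A>\<close> u' unfolding divisible_wrt_def by blast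
  then have "inflation E (f' \<cdot> u)"
    using E.inflation_cmp[OF f(6) _ f(1) u'] sq by simp
  \<comment> \<open>The kernel-cokernel pair required for cancelling \<open>f'\<close> is the
    \<open>D\<close>-conflation \<open>c\<close>.\<close>
  then show "inflation E u"
    using E.inflation_cancel[OF f'(6) _ f'(1) conflationD(1,2,3,4)[OF c]] by blast
qed

text \<open>The second condition ranges over all envelopes; perfectness supplies one, so it is not
  vacuous and yields the third. The implications run in a cycle, and the lemma serves both halves of
  the theorem.\<close>

lemma divisible_wrt_characterization:
  assumes "perfect_cotorsion_pair C D \<A> \<B>" "\<A> = {X. flat C D E X}" "X \<in> obj C"
  shows "(divisible_wrt C D E \<A> X \<longleftrightarrow>
             (\<forall>B f. is_envelope C D \<B> X B f \<longrightarrow> divisible_wrt C D E \<A> B)) \<and>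
          (divisible_wrt C D E \<A> X \<longleftrightarrow>
             (\<exists>B A f g. conflation C E X B A f g \<and> A \<in> \<A> \<and> B \<in> \<B> \<and> divisible_wrt C D E \<A> B)) \<and>
          (divisible_wrt C D E \<A> X \<longleftrightarrow>
             (\<exists>Y A f g. conflation C E X Y A f g \<and> A \<in> \<A> \<and> divisible_wrt C D E \<A> Y))"
    (is "(?i \<longleftrightarrow> ?ii) \<and> (?i \<longleftrightarrow> ?iii) \<and> (?i \<longleftrightarrow> ?iv)")
proof -
  have cp: "cotorsion_pair C D \<A> \<B>"
    using assms(1) unfolding perfect_cotorsion_pair_def by blast
  have "?ii" if ?i
    using envelope_divisible_wrt[OF cp assms(2) _ that] by blast
  moreover have ?iii if ?ii
  proof -
    obtain B f where f: "is_envelope C D \<B> X B f"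
      using assms(1,3) unfolding perfect_cotorsion_pair_def by blast
    moreover obtain A g where "conflation C E X B A f g" "A \<in> \<A>"
      using envelope_conflation[OF cp assms(2) f] .
    moreover have "B \<in> \<B>"
      using f unfolding is_envelope_def is_preenvelope_def by blast
    ultimately show ?iii
      using that by blast
  qed
  moreover have ?iv if ?iii
    using that by blast
  moreover have ?i if ?iv
    using that divisible_wrt_of_conflation[OF cp] by blast
  ultimately show ?thesis
    by blast
qed

end

theorem theorem4p9:
  fixes C :: "('o, 'm, 'e) preadditive_cat_scheme"
    and D :: "('m \<times> 'm) set"
    and \<A> \<B> :: "'o set"
  assumes "additive_category C"
    and "exact_structure C D"
    and "perfect_cotorsion_pair C D \<A> \<B>"
  shows
    "(\<forall>E. exact_structure C E \<and> \<A> = {X. flat C D E X} \<and> E \<subseteq> D \<longrightarrow>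
        (\<forall>X \<in> obj C.
          (divisible_wrt C D E \<A> X \<longleftrightarrow>
             (\<forall>B f. is_envelope C D \<B> X B f \<longrightarrow> divisible_wrt C D E \<A> B)) \<and>
          (divisible_wrt C D E \<A> X \<longleftrightarrow>
             (\<exists>B A f g. conflation C E X B A f g \<and> A \<in> \<A> \<and> B \<in> \<B> \<and> divisible_wrt C D E \<A> B)) \<and>
          (divisible_wrt C D E \<A> X \<longleftrightarrow>
             (\<exists>Y A f g. conflation C E X Y A f g \<and> A \<in> \<A> \<and> divisible_wrt C D E \<A> Y)))) \<and>
     (\<forall>E. exact_structure C E \<and> \<B> = {X. divisible C D E X} \<and> E \<subseteq> D \<longrightarrow>
        (\<forall>Z \<in> obj C.
          (flat_wrt C D E \<B> Z \<longleftrightarrow>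
             (\<forall>A f. is_cover C D \<A> Z A f \<longrightarrow> flat_wrt C D E \<B> A)) \<and>
          (flat_wrt C D E \<B> Z \<longleftrightarrow>
             (\<exists>B A f g. conflation C E B A Z f g \<and> A \<in> \<A> \<and> flat_wrt C D E \<B> A \<and> B \<in> \<B>)) \<and>
          (flat_wrt C D E \<B> Z \<longleftrightarrow>
             (\<exists>B Y f g. conflation C E B Y Z f g \<and> flat_wrt C D E \<B> Y \<and> B \<in> \<B>))))"
proof -
  interpret exact_structure C D
    by (fact assms(2))
  show ?thesis
  proof (intro conjI[OF allI allI] impI ballI; elim conjE)
    fix E X assume E: "exact_structure C E" "\<A> = {X. flat C D E X}" "E \<subseteq> D" and X: "X \<in> obj C"
    interpret exact_substructure C D E
      using E(1,3) exact_structure_axioms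
      by (intro exact_substructure.intro exact_substructure_axioms.intro)
    show "(divisible_wrt C D E \<A> X \<longleftrightarrow>
             (\<forall>B f. is_envelope C D \<B> X B f \<longrightarrow> divisible_wrt C D E \<A> B)) \<and>
          (divisible_wrt C D E \<A> X \<longleftrightarrow>
             (\<exists>B A f g. conflation C E X B A f g \<and> A \<in> \<A> \<and> B \<in> \<B> \<and> divisible_wrt C D E \<A> B)) \<and>
          (divisible_wrt C D E \<A> X \<longleftrightarrow>
             (\<exists>Y A f g. conflation C E X Y A f g \<and> A \<in> \<A> \<and> divisible_wrt C D E \<A> Y))"
      by (rule divisible_wrt_characterization[OF assms(3) E(2) X])
  next
    fix E Z assume E: "exact_structure C E" "\<B> = {X. divisible C D E X}" "E \<subseteq> D" and Z: "Z \<in> obj C"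
    \<comment> \<open>In the opposite category the cotorsion pair is (\<B>, \<A>), divisible objects
      become flat ones, and covers become envelopes, so the hypothesis on \<B> is that of the first
      half.\<close>
    have "exact_substructure (op_cat C) (D\<inverse>) (E\<inverse>)"
      using E(3) exact_structure_op exact_structure.exact_structure_op[OF E(1)]
      by (intro exact_substructure.intro exact_substructure_axioms.intro) auto
    moreover have "perfect_cotorsion_pair (op_cat C) (D\<inverse>) \<B> \<A>"
      using assms(3) unfolding perfect_cotorsion_pair_op .
    moreover have "\<B> = {X. flat (op_cat C) (D\<inverse>) (E\<inverse>) X}"
      using E(2) unfolding flat_op .
    moreover have "Z \<in> obj (op_cat C)"
      using Z by simp
    ultimately have "(flat_wrt C D E \<B> Z \<longleftrightarrow>
             (\<forall>A f. is_cover C D \<A> Z A f \<longrightarrow> flat_wrt C D E \<B> A)) \<and>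
          (flat_wrt C D E \<B> Z \<longleftrightarrow>
             (\<exists>A B f g. conflation C E B A Z g f \<and> B \<in> \<B> \<and> A \<in> \<A> \<and> flat_wrt C D E \<B> A)) \<and>
          (flat_wrt C D E \<B> Z \<longleftrightarrow>
             (\<exists>Y B f g. conflation C E B Y Z g f \<and> B \<in> \<B> \<and> flat_wrt C D E \<B> Y))"
      by (rule exact_substructure.divisible_wrt_characterization[of "op_cat C" "D\<inverse>" "E\<inverse>" \<B> \<A> Z,
            unfolded divisible_wrt_op is_envelope_op conflation_op])
    then show "(flat_wrt C D E \<B> Z \<longleftrightarrow>
             (\<forall>A f. is_cover C D \<A> Z A f \<longrightarrow> flat_wrt C D E \<B> A)) \<and>
          (flat_wrt C D E \<B> Z \<longleftrightarrow>
             (\<exists>B A f g. conflation C E B A Z f g \<and> A \<in> \<A> \<and> flat_wrt C D E \<B> A \<and> B \<in> \<B>)) \<and>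
          (flat_wrt C D E \<B> Z \<longleftrightarrow>
             (\<exists>B Y f g. conflation C E B Y Z f g \<and> flat_wrt C D E \<B> Y \<and> B \<in> \<B>))"
      by blast
  qed
qed

end
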